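(* Let $\Phi(\tau)=\int_0^\tau e^{-x^2/2}\,dx$ and $\Psi(\tau)=\tau\Phi(\tau)+e^{-\tau^2/2}$ for $\tau\ge0$. For all $f\in\mathbb R$ and $\lambda>0$, $$\mathbb L_b(f,\lambda)=\mathbb L(f,1,\lambda)=\begin{cases}\dfrac{\sqrt\lambda\,\Psi\big(|f|/\sqrt\lambda\big)}{\Psi(1)}, & 0\le|f|<\sqrt\lambda,\\[2mm] |f|, & |f|\ge\sqrt\lambda,\end{cases}\ =\ \sqrt\lambda\,\max\left(\frac{\Psi(|f|/\sqrt\lambda)}{\Psi(1)},\ \frac{|f|}{\sqrt\lambda}\right).$$
   Context: $\mathcal D$ denotes the standard collection of dyadic intervals of $\mathbb R$. For $I\in\mathcal D$, $I_-$ and $I_+$ are its left and right halves, $\mathbf 1_I$ its indicator function, and $|E|$ denotes Lebesgue measure. For integrable $\varphi$, $\langle\varphi\rangle_I=\frac1{|I|}\int_I\varphi\,dx$. Functions are real-valued. For $J\in\mathcal D$ the (localized) dyadic square function is given by $$S_J^2\varphi(x)=\sum_{I\in\mathcal D,\ I\subseteq J}|\Delta_I\varphi|^2\,\mathbf 1_I(x),\qquad \Delta_I\varphi=\tfrac12\big(\langle\varphi\rangle_{I_+}-\langle\varphi\rangle_{I_-}\big)\big(\mathbf 1_{I_+}-\mathbf 1_{I_-}\big).$$ For $f\in\mathbb R$, $0\le p\le1$, $\lambda>0$, $$\mathbb L(f,p,\lambda)=\inf\langle|\varphi|\rangle_J,$$ the infimum being over all integrable $\varphi$ supported in $J\in\mathcal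 D$ with $\langle\varphi\rangle_J=f$ and $\frac1{|J|}|\{x\in J:S_J^2\varphi(x)\ge\lambda\}|=p$; it does not depend on the choice of $J$. For $f\in\mathbb R$, $\lambda>0$, $\mathbb L_b(f,\lambda):=\mathbb L(f,1,\lambda)$, i.e. the infimum of $\langle|\varphi|\rangle_J$ over all $\varphi$ supported in $J$ with $\langle\varphi\rangle_J=f$ and $S_J^2\varphi\ge\lambda$ a.e. on $J$. *)

theory Defs
  imports "HOL-Analysis.Analysis"
begin

text \<open>Dyadic intervals are taken half-open, so those of a given length partition the line.\<close>

definition dyadic :: "real set set" where
  "dyadic = {{of_int k * 2 powi n ..< of_int (k + 1) * 2 powi n} | k n :: int. True}"

definition left_half :: "real set \<Rightarrow> real set" where
  "left_half I = {Inf I ..< (Inf I + Sup I) / 2}"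

definition right_half :: "real set \<Rightarrow> real set" where
  "right_half I = {(Inf I + Sup I) / 2 ..< Sup I}"

definition avg :: "(real \<Rightarrow> real) \<Rightarrow> real set \<Rightarrow> real" where
  "avg \<phi> I = (LINT x:I|lebesgue. \<phi> x) / measure lebesgue I"

definition mdiff :: "real set \<Rightarrow> (real \<Rightarrow> real) \<Rightarrow> real \<Rightarrow> real" where
  "mdiff I \<phi> x = 1/2 * (avg \<phi> (right_half I) - avg \<phi> (left_half I))
                  * (indicator (right_half I) x - indicator (left_half I) x)"

text \<open>The square of the localized dyadic square function. It is valued in \<^typ>\<open>ennreal\<close>
  because the series may diverge at some points.\<close>

definition sq_fun2 :: "real set \<Rightarrow> (real \<Rightarrow> real) \<Rightarrow> real \<Rightarrow> ennreal" where
  "sq_fun2 J \<phi> x =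
     (\<Sum>\<^sub>\<infinity>I\<in>{I \<in> dyadic. I \<subseteq> J}. ennreal (\<bar>mdiff I \<phi> x\<bar>\<^sup>2 * indicator I x))"

definition integrable_supported :: "real set \<Rightarrow> (real \<Rightarrow> real) \<Rightarrow> bool" where
  "integrable_supported J \<phi> \<longleftrightarrow> integrable lebesgue \<phi> \<and> (\<forall>x. x \<notin> J \<longrightarrow> \<phi> x = 0)"

text \<open>The infimum is taken in \<^typ>\<open>ereal\<close>, so that it is \<open>\<infinity>\<close> over an empty class of functions.
  The value does not depend
  on the dyadic interval \<open>J\<close>; rather than choosing one, \<open>J\<close> is kept as a parameter.\<close>

definition LL :: "real set \<Rightarrow> real \<Rightarrow> real \<Rightarrow> real \<Rightarrow> ereal" where
  "LL J f p lam = (INF \<phi> \<in> {\<phi>. integrable_supported J \<phi> \<and> avg \<phi> J = f \<and>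
       measure lebesgue {x \<in> J. sq_fun2 J \<phi> x \<ge> ennreal lam} / measure lebesgue J = p}.
     ereal (avg (\<lambda>x. \<bar>\<phi> x\<bar>) J))"

definition LLb :: "real set \<Rightarrow> real \<Rightarrow> real \<Rightarrow> ereal" where
  "LLb J f lam = LL J f 1 lam"

definition Phi :: "real \<Rightarrow> real" where
  "Phi \<tau> = integral {0..\<tau>} (\<lambda>x. exp (- (x\<^sup>2) / 2))"

definition Psi :: "real \<Rightarrow> real" where
  "Psi \<tau> = \<tau> * Phi \<tau> + exp (- (\<tau>\<^sup>2) / 2)"

lemma countable_dyadic: "countable dyadic"
proof -
  have "dyadic = (\<lambda>(k, n). {of_int k * 2 powi n ..< of_int (k + 1) * 2 powi n}) ` (UNIV :: (int \<times> int) set)"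
    by (auto simp: dyadic_def)
  then show ?thesis by (rule ssubst) (intro countable_image countableI_type)
qed

lemma dyadic_nondegenerate:
  assumes "J \<in> dyadic"
  shows "J \<in> sets lebesgue" "emeasure lebesgue J < \<infinity>" "measure lebesgue J > 0"
proof -
  obtain k n :: int where J: "J = {of_int k * 2 powi n ..< of_int (k + 1) * 2 powi n}"
    using assms by (auto simp: dyadic_def)
  have le: "of_int k * 2 powi n < (of_int (k + 1) * 2 powi n :: real)"
    by (simp add: algebra_simps)
  show "J \<in> sets lebesgue" "emeasure lebesgue J < \<infinity>" "measure lebesgue J > 0"
    using le by (simp_all add: J)
qed

lemma borel_measurable_sq_fun2: "sq_fun2 J \<phi> \<in> borel_measurable borel"
proof -
  define D where "D = {I \<in> dyadic. I \<subseteq> J}"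
  define u where "u I x = ennreal (\<bar>mdiff I \<phi> x\<bar>\<^sup>2 * indicator I x)" for I x
  have cD: "countable D"
    using countable_dyadic by (auto simp: D_def intro: countable_subset)
  have D: "I \<in> sets borel" if "I \<in> D" for I
    using that by (auto simp: D_def dyadic_def)
  have u: "u I \<in> borel_measurable borel" if "I \<in> D" for I
    using D[OF that] unfolding u_def mdiff_def left_half_def right_half_def by measurable
  have "sq_fun2 J \<phi> = (\<lambda>x. SUP F\<in>{F. finite F \<and> F \<subseteq> D}. \<Sum>I\<in>F. u I x)"
    unfolding sq_fun2_def D_def[symmetric] u_def
    by (intro ext nonneg_infsum_complete) auto
  also have "\<dots> \<in> borel_measurable borel"
    by (intro borel_measurable_SUP countable_Collect_finite_subset cD borel_measurable_sum u) auto
  finally show ?thesis .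
qed

text \<open>The constraint \<open>p = 1\<close> says that the square function satisfies
  \<open>sq_fun2 J \<phi> \<ge> lam\<close> almost everywhere on \<open>J\<close>.\<close>

lemma LLb_AE:
  assumes J: "J \<in> dyadic"
  shows "LLb J f lam = (INF \<phi> \<in> {\<phi>. integrable_supported J \<phi> \<and> avg \<phi> J = f \<and>
       (AE x in lebesgue. x \<in> J \<longrightarrow> sq_fun2 J \<phi> x \<ge> ennreal lam)}.
     ereal (avg (\<lambda>x. \<bar>\<phi> x\<bar>) J))"
proof -
  have "measure lebesgue {x \<in> J. sq_fun2 J \<phi> x \<ge> ennreal lam} / measure lebesgue J = 1 \<longleftrightarrow>
        (AE x in lebesgue. x \<in> J \<longrightarrow> sq_fun2 J \<phi> x \<ge> ennreal lam)" for \<phi>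
  proof -
    note JJ = dyadic_nondegenerate[OF J]
    let ?A = "{x \<in> J. sq_fun2 J \<phi> x \<ge> ennreal lam}"
    have m: "sq_fun2 J \<phi> \<in> borel_measurable lebesgue"
      using borel_measurable_sq_fun2 by (simp add: measurable_completion)
    have "{x \<in> space lebesgue. sq_fun2 J \<phi> x \<ge> ennreal lam} \<in> sets lebesgue"
      using m by measurable
    then have "J \<inter> {x \<in> space lebesgue. sq_fun2 J \<phi> x \<ge> ennreal lam} \<in> sets lebesgue"
      using JJ by blast
    also have "J \<inter> {x \<in> space lebesgue. sq_fun2 J \<phi> x \<ge> ennreal lam} = ?A" by auto
    finally have A: "?A \<in> sets lebesgue" .
    have fin: "J \<in> fmeasurable lebesgue" using JJ by (simp add: fmeasurable_def)
    have Af: "?A \<in> fmeasurable lebesgue"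
      by (rule fmeasurableI2[OF fin _ A]) auto
    have md: "measure lebesgue (J - ?A) = measure lebesgue J - measure lebesgue ?A"
      by (rule measurable_measure_Diff[OF fin A]) auto
    have DA: "J - ?A \<in> fmeasurable lebesgue" using fin A by (rule fmeasurable_Diff)
    have "measure lebesgue ?A / measure lebesgue J = 1 \<longleftrightarrow> measure lebesgue (J - ?A) = 0"
      using JJ(3) md by (auto simp: field_simps)
    also have "\<dots> \<longleftrightarrow> emeasure lebesgue (J - ?A) = 0"
      using emeasure_eq_measure2[OF DA] by simp
    also have "\<dots> \<longleftrightarrow> J - ?A \<in> null_sets lebesgue"
      using JJ(1) A by (auto simp: null_sets_def)
    also have "\<dots> \<longleftrightarrow> (AE x in lebesgue. x \<notin> J - ?A)"
      using JJ(1) A by (intro AE_iff_null_sets) auto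
    also have "\<dots> \<longleftrightarrow> (AE x in lebesgue. x \<in> J \<longrightarrow> sq_fun2 J \<phi> x \<ge> ennreal lam)"
      by (intro AE_cong) auto
    finally show ?thesis .
  qed
  then show ?thesis by (simp add: LLb_def LL_def)
qed

end

theory Submission
  imports Defs
begin

text \<open>
  With \<open>B(f, l) = \<bar>f\<bar>\<close> for \<open>l \<le> f\<^sup>2\<close> and \<open>B(f, l) = sqrt l * Psi (\<bar>f\<bar> / sqrt l) / Psi 1\<close> otherwise, the
  value of the problem is \<open>B\<close>. Splitting \<open>J\<close> replaces \<open>(f, l)\<close> by \<open>(f \<plusminus> d, l - d\<^sup>2)\<close>, where \<open>d\<close> is
  half the difference of the averages over the two halves.

  Lower bound: \<open>B\<close> satisfies \<open>2 B(f, l) \<le> B(f + d, l - d\<^sup>2) + B(f - d, l - d\<^sup>2)\<close>. Iterating this over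
  the dyadic generations and using \<open>B(f, l) \<le> \<bar>f\<bar> + sqrt (max 0 l)\<close>, the second term vanishes in
  the limit by dominated convergence, because the square function exhausts \<open>l\<close>.

  Upper bound: on \<open>f\<^sup>2 < l\<close> the function \<open>B\<close> solves the backward heat equation, so a random walk
  with small steps \<open>\<plusminus>d\<close> loses only \<open>O(d\<^sup>3)\<close> per step as long as \<open>l\<close> stays away from \<open>0\<close>. When the walk
  leaves \<open>f\<^sup>2 < l\<close>, one last split with \<open>d = f\<close> reaches the square function bound without changing
  the sign of the function.
\<close>

section \<open>Gaussian functions and the heat equation\<close>

definition gauss :: "real \<Rightarrow> real" where
  "gauss x = exp (- (x\<^sup>2) / 2)"

text \<open>\<open>Phi\<close> vanishes on the negative half-line; the extensions below are the odd one of \<open>Phi\<close>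
  and the even one of \<open>Psi\<close>.\<close>

definition Phi_ext :: "real \<Rightarrow> real" where
  "Phi_ext x = (LBINT y=0..ereal x. gauss y)"

definition Psi_ext :: "real \<Rightarrow> real" where
  "Psi_ext x = x * Phi_ext x + gauss x"

lemma gauss_pos: "gauss x > 0"
  by (simp add: gauss_def)

lemma gauss_minus [simp]: "gauss (- x) = gauss x"
  by (simp add: gauss_def)

lemma gauss_deriv [derivative_intros]:
  "(g has_real_derivative g') (at x within S) \<Longrightarrow>
   ((\<lambda>x. gauss (g x)) has_real_derivative - g x * gauss (g x) * g') (at x within S)"
  unfolding gauss_def by (auto intro!: derivative_eq_intros simp: algebra_simps)

lemma continuous_on_gauss: "continuous_on S gauss"
  unfolding gauss_def by (intro continuous_intros) auto

lemma Phi_ext_0 [simp]: "Phi_ext 0 = 0"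
  by (simp add: Phi_ext_def zero_ereal_def[symmetric])

lemma Phi_ext_deriv_at: "(Phi_ext has_real_derivative gauss x) (at x)"
proof -
  \<comment> \<open>The margin of 1 puts \<open>x\<close> in the interior of the interval, so the
    derivative within it is the derivative at \<open>x\<close>, for either sign of
    \<open>x\<close>.\<close>
  let ?a = "min 0 x - 1" and ?b = "max 0 x + 1"
  have "((\<lambda>u. LBINT y=ereal 0..u. gauss y) has_vector_derivative gauss x) (at x within {?a..?b})"
    by (rule interval_integral_FTC2) (auto intro: continuous_on_gauss)
  moreover have "at x within {?a..?b} = at x"
    by (rule at_within_Icc_at) auto
  ultimately show ?thesis
    unfolding Phi_ext_def[abs_def] has_real_derivative_iff_has_vector_derivative
    by (simp add: zero_ereal_def)
qed

lemma Phi_ext_deriv [derivative_intros]: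
  "(g has_real_derivative g') (at x within S) \<Longrightarrow>
   ((\<lambda>x. Phi_ext (g x)) has_real_derivative gauss (g x) * g') (at x within S)"
  by (rule DERIV_chain2[OF Phi_ext_deriv_at])

lemma Psi_ext_deriv [derivative_intros]:
  "(g has_real_derivative g') (at x within S) \<Longrightarrow>
   ((\<lambda>x. Psi_ext (g x)) has_real_derivative Phi_ext (g x) * g') (at x within S)"
  unfolding Psi_ext_def by (auto intro!: derivative_eq_intros simp: algebra_simps)

lemma Phi_ext_minus [simp]: "Phi_ext (- x) = - Phi_ext x"
proof -
  have "Phi_ext x + Phi_ext (- x) = Phi_ext 0 + Phi_ext (- 0)"
    by (rule DERIV_isconst_all[of "\<lambda>x. Phi_ext x + Phi_ext (- x)"])
       (auto intro!: derivative_eq_intros)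
  then show ?thesis by simp
qed

lemma Psi_ext_minus [simp]: "Psi_ext (- x) = Psi_ext x"
  by (simp add: Psi_ext_def)

lemma Psi_ext_abs [simp]: "Psi_ext \<bar>x\<bar> = Psi_ext x"
  by (simp add: abs_if)

lemma Psi_ext_0 [simp]: "Psi_ext 0 = 1"
  by (simp add: Psi_ext_def gauss_def)

lemma Phi_ext_mono: "x \<le> y \<Longrightarrow> Phi_ext x \<le> Phi_ext y"
  by (rule DERIV_nonneg_imp_nondecreasing)
     (use gauss_pos in \<open>auto intro: Phi_ext_deriv_at less_imp_le\<close>)

lemma Phi_ext_nonneg: "0 \<le> x \<Longrightarrow> 0 \<le> Phi_ext x"
  using Phi_ext_mono[of 0 x] by simp

lemma Phi_eq_Phi_ext: "0 \<le> x \<Longrightarrow> Phi x = Phi_ext x"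
proof -
  assume "0 \<le> x"
  have "(gauss has_integral Phi_ext x - Phi_ext 0) {0..x}"
    by (rule fundamental_theorem_of_calculus[OF \<open>0 \<le> x\<close>])
       (auto simp flip: has_real_derivative_iff_has_vector_derivative
             intro: has_field_derivative_at_within Phi_ext_deriv_at)
  then show ?thesis
    by (simp add: Phi_def gauss_def[abs_def] integral_unique)
qed

lemma Psi_eq_Psi_ext: "0 \<le> x \<Longrightarrow> Psi x = Psi_ext x"
  by (simp add: Psi_def Psi_ext_def Phi_eq_Phi_ext gauss_def)

lemma Psi_ext_mono: "0 \<le> x \<Longrightarrow> x \<le> y \<Longrightarrow> Psi_ext x \<le> Psi_ext y"
  by (rule DERIV_nonneg_imp_nondecreasing)
     (auto intro!: exI derivative_eq_intros Phi_ext_nonneg)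

lemma Psi_ext_ge_1: "1 \<le> Psi_ext x"
  using Psi_ext_mono[of 0 "\<bar>x\<bar>"] by simp

lemma Psi_ext_pos: "0 < Psi_ext x"
  using Psi_ext_ge_1[of x] by linarith

text \<open>The derivative has numerator \<open>x * Phi_ext x - Psi_ext x = - gauss x\<close>. This
  monotonicity decides which branch of \<open>bellman\<close> is larger on either side of 1.\<close>

lemma Psi_ext_over_antimono:
  assumes "0 < s" "s \<le> t"
  shows "Psi_ext t / t \<le> Psi_ext s / s"
proof (rule DERIV_nonpos_imp_nonincreasing[OF assms(2)])
  fix x assume "s \<le> x"
  then have "x > 0" using assms by simp
  then have "((\<lambda>x. Psi_ext x / x) has_real_derivative - gauss x / x\<^sup>2) (at x)"
    by (auto intro!: derivative_eq_intros simp: Psi_ext_def power2_eq_square)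
  moreover have "- gauss x / x\<^sup>2 \<le> 0"
    using gauss_pos[of x] by simp
  ultimately show "\<exists>y. ((\<lambda>x. Psi_ext x / x) has_real_derivative y) (at x) \<and> y \<le> 0"
    by blast
qed

lemma le_Psi_ext_quotient: "\<bar>x\<bar> \<le> 1 \<Longrightarrow> \<bar>x\<bar> \<le> Psi_ext x / Psi_ext 1"
  using Psi_ext_over_antimono[of "\<bar>x\<bar>" 1] Psi_ext_pos[of 1] Psi_ext_pos[of x]
  by (cases "x = 0") (auto simp: field_simps)

lemma Psi_ext_quotient_le: "1 \<le> \<bar>x\<bar> \<Longrightarrow> Psi_ext x / Psi_ext 1 \<le> \<bar>x\<bar>"
  using Psi_ext_over_antimono[of 1 "\<bar>x\<bar>"] Psi_ext_pos[of 1]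
  by (auto simp: field_simps)

text \<open>Concavity on \<open>[-1, 1]\<close>: the second derivative is
  \<open>(x^2 - 1) * gauss x\<close>.\<close>

lemma gauss_below_tangent:
  assumes "p \<in> {-1..1}" "q \<in> {-1..1}"
  shows "gauss q \<le> gauss p - p * gauss p * (q - p)"
proof -
  have "p * gauss p * (q - p) \<le> - gauss q - - gauss p"
  proof (rule f''_imp_f'[where C = "{-1..1}"])
    fix x :: real assume x: "x \<in> {-1..1}"
    show "((\<lambda>x. - gauss x) has_real_derivative x * gauss x) (at x)"
      by (auto intro!: derivative_eq_intros)
    show "((\<lambda>x. x * gauss x) has_real_derivative (1 - x\<^sup>2) * gauss x) (at x)"
      by (auto intro!: derivative_eq_intros simp: power2_eq_square algebra_simps)
    show "0 \<le> (1 - x\<^sup>2) * gauss x"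
      using x gauss_pos[of x] by (auto intro!: mult_nonneg_nonneg simp: abs_square_le_1)
  qed (use assms in auto)
  then show ?thesis by simp
qed

text \<open>The trapezoid rule underestimates the integral of a concave function. The derivative of
  the error in \<open>p\<close> is half the gap between \<open>gauss q\<close> and the tangent at
  \<open>p\<close>.\<close>

lemma gauss_trapezoid:
  assumes "-1 \<le> q" "q \<le> p" "p \<le> 1"
  shows "(p - q) / 2 * (gauss p + gauss q) \<le> Phi_ext p - Phi_ext q"
proof -
  let ?T = "\<lambda>p. Phi_ext p - Phi_ext q - (p - q) / 2 * (gauss p + gauss q)"
  have "?T q \<le> ?T p"
  proof (rule DERIV_nonneg_imp_nondecreasing[OF assms(2)])
    fix x assume x: "q \<le> x" "x \<le> p"
    have "(?T has_real_derivative (gauss x - x * gauss x * (q - x) - gauss q) / 2) (at x)"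
      by (auto intro!: derivative_eq_intros simp: field_simps)
    moreover have "0 \<le> (gauss x - x * gauss x * (q - x) - gauss q) / 2"
      using gauss_below_tangent[of x q] x assms by auto
    ultimately show "\<exists>y. (?T has_real_derivative y) (at x) \<and> 0 \<le> y"
      by blast
  qed
  then show ?thesis by simp
qed

lemma gauss_lipschitz: "x \<le> y \<Longrightarrow> \<bar>gauss y - gauss x\<bar> \<le> y - x"
proof -
  assume "x \<le> y"
  have b: "\<bar>z * gauss z\<bar> \<le> 1" for z :: real
  proof -
    have "\<bar>z\<bar> \<le> 1 + z\<^sup>2 / 2"
      using sum_squares_ge_zero[of "\<bar>z\<bar> - 1" 0] by (simp add: power2_eq_square algebra_simps)
    also have "\<dots> \<le> exp (z\<^sup>2 / 2)" by (rule exp_ge_add_one_self)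
    finally have "\<bar>z\<bar> * gauss z \<le> exp (z\<^sup>2 / 2) * gauss z"
      using gauss_pos[of z] by (intro mult_right_mono) auto
    also have "\<dots> = 1" by (simp add: gauss_def flip: exp_add)
    finally show ?thesis using gauss_pos[of z] by (simp add: abs_mult)
  qed
  have "norm (gauss y - gauss x) \<le> 1 * norm (y - x)"
  proof (rule field_differentiable_bound[of UNIV gauss "\<lambda>z. - z * gauss z"])
    show "(gauss has_field_derivative - z * gauss z) (at z within UNIV)" for z
      using gauss_deriv[OF DERIV_ident, of z] by simp
  qed (use b in \<open>auto simp: abs_mult\<close>)
  then show ?thesis using \<open>x \<le> y\<close> by simp
qed

text \<open>By the mean value theorem the integral is \<open>(p - q) * gauss z\<close>, and the
  Lipschitz bound compares \<open>gauss z\<close> with both end values. This holds on the whole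
  line, beyond the range of concavity.\<close>

lemma gauss_trapezoid_upper:
  assumes "q \<le> p"
  shows "Phi_ext p - Phi_ext q - (p - q) / 2 * (gauss p + gauss q) \<le> (p - q)\<^sup>2"
proof (cases "q = p")
  case False
  then have "q < p" using assms by simp
  from MVT2[OF this, of Phi_ext gauss] obtain z
    where z: "q < z" "z < p" "Phi_ext p - Phi_ext q = (p - q) * gauss z"
    using Phi_ext_deriv_at by auto
  have "gauss z - (gauss p + gauss q) / 2 \<le> p - q"
    using gauss_lipschitz[of q z] gauss_lipschitz[of z p] z by (simp add: abs_le_iff field_simps)
  then have "(p - q) * (gauss z - (gauss p + gauss q) / 2) \<le> (p - q) * (p - q)"
    using assms by (intro mult_left_mono) auto
  then show ?thesis using z by (simp add: algebra_simps power2_eq_square)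
qed auto

text \<open>\<open>Phi_ext + gauss\<close> increases up to 1, where it equals
  \<open>Psi_ext 1\<close>. The left side occurs as the slope of \<open>heat\<close> in
  \<open>heat_midpoint_exit\<close>.\<close>

lemma Phi_ext_plus_gauss_le:
  assumes "z \<le> 1" "w \<le> 1"
  shows "Phi_ext z + w * gauss z \<le> Psi_ext 1"
proof -
  have "Phi_ext z + w * gauss z \<le> Phi_ext z + gauss z"
    using assms gauss_pos[of z] by simp
  also have "\<dots> \<le> Phi_ext 1 + gauss 1"
  proof (rule DERIV_nonneg_imp_nondecreasing[OF assms(1), of "\<lambda>z. Phi_ext z + gauss z"])
    fix x :: real assume "x \<le> 1"
    then have "((\<lambda>z. Phi_ext z + gauss z) has_real_derivative (1 - x) * gauss x) (at x)"
      "0 \<le> (1 - x) * gauss x"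
      using gauss_pos[of x] by (auto intro!: derivative_eq_intros simp: algebra_simps)
    then show "\<exists>y. ((\<lambda>z. Phi_ext z + gauss z) has_real_derivative y) (at x) \<and> 0 \<le> y" by blast
  qed
  finally show ?thesis by (simp add: Psi_ext_def)
qed

text \<open>A solution of \<open>2 heat\<^sub>v = heat\<^sub>u\<^sub>u\<close>.\<close>

definition heat :: "real \<Rightarrow> real \<Rightarrow> real" where
  "heat u v = sqrt v * Psi_ext (u / sqrt v)"

text \<open>The multiples of \<open>u * Phi_ext\<close> cancel; the partial derivatives are
  \<open>Phi_ext (u / sqrt v)\<close> and \<open>gauss (u / sqrt v) / (2 * sqrt v)\<close>.\<close>

lemma heat_deriv:
  assumes "(u has_real_derivative u') (at t)" "(v has_real_derivative v') (at t)" "v t > 0"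
  shows "((\<lambda>t. heat (u t) (v t)) has_real_derivative
     u' * Phi_ext (u t / sqrt (v t)) + v' * gauss (u t / sqrt (v t)) / (2 * sqrt (v t))) (at t)"
proof -
  define s where "s = sqrt (v t)"
  have s: "s > 0" "v t = s * s" using assms by (auto simp: s_def)
  have r: "((\<lambda>t. sqrt (v t)) has_real_derivative v' / (2 * s)) (at t)"
    using DERIV_chain2[OF DERIV_real_sqrt[OF assms(3)] assms(2)] by (simp add: s_def field_simps)
  have q: "((\<lambda>t. u t / sqrt (v t)) has_real_derivative
      (u' * s - u t * (v' / (2 * s))) / (s * s)) (at t)"
    using DERIV_divide[OF assms(1) r] s(1) by (simp add: s_def)
  have "((\<lambda>t. heat (u t) (v t)) has_real_derivative
     (v' / (2 * s)) * Psi_ext (u t / s)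
      + (Phi_ext (u t / s) * ((u' * s - u t * (v' / (2 * s))) / (s * s))) * s) (at t)"
    using DERIV_mult[OF r Psi_ext_deriv[OF q]] by (simp add: heat_def s_def)
  moreover have "(v' / (2 * s)) * Psi_ext (u t / s)
      + (Phi_ext (u t / s) * ((u' * s - u t * (v' / (2 * s))) / (s * s))) * s
    = u' * Phi_ext (u t / s) + v' * gauss (u t / s) / (2 * s)"
  proof -
    have "v' / (2 * s) * (a / s * P + g) + P * ((u' * s - a * (v' / (2 * s))) / (s * s)) * s
        = u' * P + v' * g / (2 * s)" for a P g
      using s(1) by (simp add: field_simps)
    then show ?thesis by (simp add: Psi_ext_def)
  qed
  ultimately show ?thesis by (simp add: s_def)
qed

lemma heat_minus [simp]: "heat (- u) v = heat u v"
  by (simp add: heat_def)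

lemma heat_abs [simp]: "heat \<bar>u\<bar> v = heat u v"
  by (simp add: abs_if)

lemma heat_nonneg: "0 \<le> v \<Longrightarrow> 0 \<le> heat u v"
  using Psi_ext_pos by (simp add: heat_def less_imp_le)

lemma heat_diag: "0 < v \<Longrightarrow> heat (sqrt v) v = sqrt v * Psi_ext 1"
  by (simp add: heat_def)

lemma heat_mono:
  assumes "\<bar>u\<bar> \<le> \<bar>u'\<bar>" "0 < v"
  shows "heat u v \<le> heat u' v"
proof -
  have "Psi_ext (\<bar>u\<bar> / sqrt v) \<le> Psi_ext (\<bar>u'\<bar> / sqrt v)"
    using assms by (intro Psi_ext_mono divide_right_mono) auto
  then have "heat \<bar>u\<bar> v \<le> heat \<bar>u'\<bar> v"
    using assms by (simp add: heat_def del: heat_abs)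
  then show ?thesis by simp
qed

section \<open>The main inequality\<close>

text \<open>Since \<open>(p - q) / 2 = t / sqrt (l - t^2)\<close>, the derivative is half the error
  of the trapezoid rule for \<open>gauss\<close> on \<open>[q, p]\<close>. Its sign and its size
  give the two estimates that follow.\<close>

lemma heat_midpoint_deriv:
  fixes f l t :: real
  assumes "t\<^sup>2 < l"
  defines "p \<equiv> (f + t) / sqrt (l - t\<^sup>2)" and "q \<equiv> (f - t) / sqrt (l - t\<^sup>2)"
  shows "((\<lambda>t. (heat (f + t) (l - t\<^sup>2) + heat (f - t) (l - t\<^sup>2)) / 2) has_real_derivative
    (Phi_ext p - Phi_ext q - (p - q) / 2 * (gauss p + gauss q)) / 2) (at t)"
proof -
  let ?s = "sqrt (l - t\<^sup>2)"
  have s: "?s > 0" using assms by simp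
  have v: "((\<lambda>t. l - t\<^sup>2) has_real_derivative - 2 * t) (at t)"
    by (auto intro!: derivative_eq_intros)
  have p: "((\<lambda>t. f + t) has_real_derivative 1) (at t)"
    and q: "((\<lambda>t. f - t) has_real_derivative - 1) (at t)"
    by (auto intro!: derivative_eq_intros)
  have "((\<lambda>t. (heat (f + t) (l - t\<^sup>2) + heat (f - t) (l - t\<^sup>2)) / 2) has_real_derivative
    ((1 * Phi_ext p + - 2 * t * gauss p / (2 * ?s))
      + (- 1 * Phi_ext q + - 2 * t * gauss q / (2 * ?s))) / 2) (at t)"
    using assms heat_deriv[OF p v] heat_deriv[OF q v]
    by (intro DERIV_cdivide DERIV_add) auto
  moreover have "(p - q) / 2 = t / ?s"
    unfolding p_def q_def by (simp flip: diff_divide_distrib)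
  then have "(1 * Phi_ext p + - 2 * t * gauss p / (2 * ?s))
      + (- 1 * Phi_ext q + - 2 * t * gauss q / (2 * ?s))
    = Phi_ext p - Phi_ext q - (p - q) / 2 * (gauss p + gauss q)"
    by (simp add: algebra_simps)
  ultimately show ?thesis by (simp only:)
qed

text \<open>While both endpoints stay in \<open>u^2 <= v\<close>, the arguments of
  \<open>gauss\<close> lie in \<open>[-1, 1]\<close>, so the average increases with the step from
  its value \<open>heat f l\<close> at 0.\<close>

lemma heat_midpoint_interior:
  assumes "0 \<le> d" "d\<^sup>2 < l" "\<bar>f\<bar> + d \<le> sqrt (l - d\<^sup>2)"
  shows "heat f l \<le> (heat (f + d) (l - d\<^sup>2) + heat (f - d) (l - d\<^sup>2)) / 2"
proof -
  let ?H = "\<lambda>t. (heat (f + t) (l - t\<^sup>2) + heat (f - t) (l - t\<^sup>2)) / 2"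
  have "?H 0 \<le> ?H d"
  proof (rule DERIV_nonneg_imp_nondecreasing[OF assms(1)])
    fix t assume t: "0 \<le> t" "t \<le> d"
    let ?s = "sqrt (l - t\<^sup>2)"
    have le: "t\<^sup>2 \<le> d\<^sup>2" using t by (intro power_mono) auto
    then have l: "t\<^sup>2 < l" using assms by simp
    have "\<bar>f\<bar> + t \<le> sqrt (l - d\<^sup>2)" using assms t by simp
    also have "\<dots> \<le> ?s" using le by simp
    finally have s: "\<bar>f\<bar> + t \<le> ?s" .
    have "?s > 0" using l by simp
    then have "- 1 \<le> (f - t) / ?s" "(f - t) / ?s \<le> (f + t) / ?s" "(f + t) / ?s \<le> 1"
      using s t by (auto simp: le_divide_eq divide_le_eq divide_le_cancel abs_if split: if_splits)
    from gauss_trapezoid[OF this] heat_midpoint_deriv[OF l, of f]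
    show "\<exists>y. (?H has_real_derivative y) (at t) \<and> 0 \<le> y"
      by (intro exI conjI) auto
  qed
  then show ?thesis by simp
qed

text \<open>A quadratic trapezoid error times the step length makes the loss of one step cubic in
  \<open>d\<close>. Spending \<open>l\<close> takes about \<open>l / d^2\<close> steps, so away from
  \<open>l = 0\<close> the total loss is of order \<open>d\<close>.\<close>

lemma heat_midpoint_upper:
  assumes "0 < d" "d\<^sup>2 < l"
  shows "(heat (f + d) (l - d\<^sup>2) + heat (f - d) (l - d\<^sup>2)) / 2 \<le> heat f l + 2 * d ^ 3 / (l - d\<^sup>2)"
proof -
  let ?H = "\<lambda>t. (heat (f + t) (l - t\<^sup>2) + heat (f - t) (l - t\<^sup>2)) / 2"
  define p where "p t = (f + t) / sqrt (l - t\<^sup>2)" for t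
  define q where "q t = (f - t) / sqrt (l - t\<^sup>2)" for t
  have l: "t\<^sup>2 < l" if "0 \<le> t" "t \<le> d" for t
    using power_mono[OF that(2,1), of 2] assms by linarith
  have "(?H has_real_derivative
      (Phi_ext (p t) - Phi_ext (q t) - (p t - q t) / 2 * (gauss (p t) + gauss (q t))) / 2) (at t)"
    if "0 \<le> t" "t \<le> d" for t
    unfolding p_def q_def by (rule heat_midpoint_deriv[OF l[OF that]])
  from MVT2[OF assms(1) this] obtain z where z: "0 < z" "z < d" "?H d - ?H 0 =
      (d - 0) * ((Phi_ext (p z) - Phi_ext (q z) - (p z - q z) / 2 * (gauss (p z) + gauss (q z))) / 2)"
    by blast
  have zl: "z\<^sup>2 \<le> d\<^sup>2" using z by (intro power_mono) auto
  have pq: "p z - q z = 2 * z / sqrt (l - z\<^sup>2)"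
    unfolding p_def q_def by (simp flip: diff_divide_distrib)
  have "0 \<le> p z - q z" using z l[of z] by (auto simp: pq)
  then have "Phi_ext (p z) - Phi_ext (q z) - (p z - q z) / 2 * (gauss (p z) + gauss (q z)) \<le> (p z - q z)\<^sup>2"
    by (intro gauss_trapezoid_upper) auto
  also have "\<dots> = 4 * z\<^sup>2 / (l - z\<^sup>2)"
    using l[of z] z by (simp add: pq power_divide power_mult_distrib)
  also have "\<dots> = 2 * (2 * z\<^sup>2 / (l - z\<^sup>2))"
    by simp
  also have "\<dots> \<le> 2 * (2 * d\<^sup>2 / (l - d\<^sup>2))"
    using zl assms by (intro mult_left_mono frac_le) auto
  finally have "?H d - ?H 0 \<le> (d - 0) * (2 * d\<^sup>2 / (l - d\<^sup>2))"
    unfolding z(3) using assms by (intro mult_left_mono) auto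
  also have "(d - 0) * (2 * d\<^sup>2 / (l - d\<^sup>2)) = 2 * d ^ 3 / (l - d\<^sup>2)"
    by (simp add: power3_eq_cube power2_eq_square)
  finally show ?thesis unfolding diff_le_eq by (simp add: add.commute)
qed

text \<open>The right endpoint \<open>(a + 2 d, m)\<close> has left the region \<open>u\<^sup>2 < v\<close>, and the left endpoint \<open>(a, m)\<close> is
  kept fixed while \<open>d\<close> grows from the value at which the right endpoint lies on the boundary.\<close>

lemma heat_midpoint_exit:
  assumes "0 < m" "\<bar>a\<bar> \<le> sqrt m" "(sqrt m - a) / 2 \<le> d" "a\<^sup>2 + 2 * a * d \<le> m"
  shows "heat (a + d) (m + d\<^sup>2) / Psi_ext 1 \<le> (a + 2 * d + heat a m / Psi_ext 1) / 2"
proof -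
  define d0 where "d0 = (sqrt m - a) / 2"
  \<comment> \<open>Twice the right side minus the left side of the claim, as a function of the
    step.\<close>
  define K where "K t = a + 2 * t + heat a m / Psi_ext 1 - 2 * heat (a + t) (m + t\<^sup>2) / Psi_ext 1" for t
  have d0: "0 \<le> d0" "d0 \<le> d" "a + 2 * d0 = sqrt m"
    using assms by (auto simp: d0_def diff_divide_distrib)
  have "0 \<le> K d0"
  proof -
    \<comment> \<open>At \<open>d0\<close> the right endpoint lies on the boundary, so the interior
      inequality applies and \<open>heat / Psi_ext 1\<close> there equals
      \<open>sqrt m\<close>.\<close>
    have "heat (a + d0) (m + d0\<^sup>2) \<le> (heat (a + d0 + d0) (m + d0\<^sup>2 - d0\<^sup>2)
        + heat (a + d0 - d0) (m + d0\<^sup>2 - d0\<^sup>2)) / 2"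
      using assms d0 by (intro heat_midpoint_interior) (auto simp: d0_def abs_if field_simps)
    also have "\<dots> = (sqrt m * Psi_ext 1 + heat a m) / 2"
      using d0 heat_diag[OF assms(1)] by (simp add: add.assoc)
    finally have "2 * heat (a + d0) (m + d0\<^sup>2) / Psi_ext 1
        \<le> (sqrt m * Psi_ext 1 + heat a m) / Psi_ext 1"
      using Psi_ext_pos[of 1] by (intro divide_right_mono) auto
    then show ?thesis
      using Psi_ext_pos[of 1] d0(3) by (simp add: K_def add_divide_distrib)
  qed
  also have "K d0 \<le> K d"
  proof (rule DERIV_nonneg_imp_nondecreasing[OF d0(2)])
    fix t assume t: "d0 \<le> t" "t \<le> d"
    have t0: "0 \<le> t" using t d0 by simp
    define s where "s = sqrt (m + t\<^sup>2)"
    have pos: "0 < m + t\<^sup>2" using assms by (simp add: add_pos_nonneg)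
    then have s: "s > 0" "s\<^sup>2 = m + t\<^sup>2" by (auto simp: s_def)
    have u: "((\<lambda>t. a + t) has_real_derivative 1) (at t)"
      and v: "((\<lambda>t. m + t\<^sup>2) has_real_derivative 2 * t) (at t)"
      by (auto intro!: derivative_eq_intros)
    define y where "y = 2 - 2 * (1 * Phi_ext ((a + t) / s) + 2 * t * gauss ((a + t) / s) / (2 * s)) / Psi_ext 1"
    have "(K has_real_derivative y) (at t)"
      unfolding K_def[abs_def] y_def using heat_deriv[OF u v pos]
      using Psi_ext_pos[of 1] by (auto intro!: derivative_eq_intros simp: s_def)
    moreover have "0 \<le> y"
    proof -
      \<comment> \<open>Equivalent to \<open>(a + t)^2 <= m + t^2\<close>: the midpoint remains in
        the region for all steps up to \<open>d\<close>.\<close>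
      have "a\<^sup>2 + 2 * a * t \<le> m"
      proof (cases "a \<ge> 0")
        case True
        then have "2 * a * t \<le> 2 * a * d" using t by (intro mult_left_mono) auto
        then show ?thesis using assms by simp
      next
        case False
        have "a\<^sup>2 \<le> m" using assms(2) real_sqrt_le_iff[of "a\<^sup>2" m] by (simp only: real_sqrt_abs)
        moreover have "a * t \<le> 0" using False t0 by (simp add: mult_nonpos_nonneg)
        ultimately show ?thesis by simp
      qed
      then have "(a + t)\<^sup>2 \<le> s\<^sup>2"
        by (simp add: s power2_sum)
      then have "a + t \<le> s" using s by (meson less_imp_le power2_le_imp_le)
      moreover have "t \<le> s" using t0 assms by (auto simp: s_def intro!: real_le_rsqrt)
      ultimately have "Phi_ext ((a + t) / s) + t / s * gauss ((a + t) / s) \<le> Psi_ext 1"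
        using s by (intro Phi_ext_plus_gauss_le) auto
      then show ?thesis
        using Psi_ext_pos[of 1] by (simp add: y_def divide_le_eq)
    qed
    ultimately show "\<exists>y. (K has_real_derivative y) (at t) \<and> 0 \<le> y" by blast
  qed
  finally show ?thesis by (simp add: K_def mult.commute)
qed

text \<open>For \<open>l \<le> 0\<close> the constraint is void, and the first branch gives the correct value \<open>\<bar>f\<bar>\<close>.\<close>

definition bellman :: "real \<Rightarrow> real \<Rightarrow> real" where
  "bellman f l = (if l \<le> f\<^sup>2 then \<bar>f\<bar> else heat f l / Psi_ext 1)"

lemma bellman_minus [simp]: "bellman (- f) l = bellman f l"
  by (simp add: bellman_def)

lemma less_power2_iff_sqrt: "(f::real)\<^sup>2 < l \<longleftrightarrow> \<bar>f\<bar> < sqrt l"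
  by (metis real_less_rsqrt real_sqrt_abs real_sqrt_less_iff)

text \<open>Together with \<open>abs_le_bellman\<close> this shows that, for \<open>l > 0\<close>,
  \<open>bellman\<close> is the larger of its two branches. At an endpoint of a split it may thus be
  bounded below by whichever branch suits.\<close>

lemma heat_le_bellman:
  assumes "0 < l"
  shows "heat f l / Psi_ext 1 \<le> bellman f l"
proof (cases "l \<le> f\<^sup>2")
  case True
  then have "sqrt l \<le> \<bar>f\<bar>" using less_power2_iff_sqrt[of f l] by linarith
  then have "Psi_ext (f / sqrt l) / Psi_ext 1 \<le> \<bar>f / sqrt l\<bar>"
    using assms by (intro Psi_ext_quotient_le) auto
  then have "sqrt l * (Psi_ext (f / sqrt l) / Psi_ext 1) \<le> sqrt l * \<bar>f / sqrt l\<bar>"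
    using assms by (intro mult_left_mono) auto
  then show ?thesis using True assms by (simp add: bellman_def heat_def)
qed (simp add: bellman_def)

lemma abs_le_bellman: "\<bar>f\<bar> \<le> bellman f l"
proof (cases "l \<le> f\<^sup>2")
  case False
  then have l: "\<bar>f\<bar> < sqrt l" "l > 0" using less_power2_iff_sqrt[of f l] le_less_trans[of 0 "f\<^sup>2" l] by auto
  then have "\<bar>f / sqrt l\<bar> \<le> Psi_ext (f / sqrt l) / Psi_ext 1"
    by (intro le_Psi_ext_quotient) auto
  then have "sqrt l * \<bar>f / sqrt l\<bar> \<le> sqrt l * (Psi_ext (f / sqrt l) / Psi_ext 1)"
    using l by (intro mult_left_mono) auto
  then show ?thesis using False l by (simp add: bellman_def heat_def)
qed (simp add: bellman_def)

lemma bellman_le_sqrt: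
  assumes "\<bar>f\<bar> \<le> sqrt l" "0 < l"
  shows "bellman f l \<le> sqrt l"
proof -
  have "heat f l \<le> heat (sqrt l) l" using assms by (intro heat_mono) auto
  then have "heat f l / Psi_ext 1 \<le> sqrt l"
    using heat_diag[OF assms(2)] Psi_ext_pos[of 1] by (simp add: divide_le_eq)
  then show ?thesis using assms by (simp add: bellman_def)
qed

text \<open>This growth bound starts the iteration over generations: the unspent part of
  \<open>l\<close> costs at most its square root.\<close>

lemma bellman_le: "bellman f l \<le> \<bar>f\<bar> + sqrt (max 0 l)"
proof (cases "l \<le> f\<^sup>2")
  case False
  then have l: "\<bar>f\<bar> < sqrt l" "l > 0" using less_power2_iff_sqrt[of f l] le_less_trans[of 0 "f\<^sup>2" l] by auto
  then show ?thesis using bellman_le_sqrt[of f l] by simp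
qed (simp add: bellman_def)

lemma bellman_main_nonneg:
  assumes "0 \<le> f" "0 \<le> d"
  shows "bellman f l \<le> (bellman (f + d) (l - d\<^sup>2) + bellman (f - d) (l - d\<^sup>2)) / 2" (is "_ \<le> ?R")
proof -
  have "f + d \<le> bellman (f + d) (l - d\<^sup>2)" "f - d \<le> bellman (f - d) (l - d\<^sup>2)"
    "- (f - d) \<le> bellman (f - d) (l - d\<^sup>2)"
    by (rule order_trans[OF _ abs_le_bellman], simp)+
  \<comment> \<open>The average of \<open>|f + d|\<close> and \<open>|f - d|\<close> is the larger
    of \<open>f\<close> and \<open>d\<close>.\<close>
  then have R: "f \<le> ?R" "d \<le> ?R" by argo+
  show ?thesis
  proof (cases "l \<le> f\<^sup>2")
    case True
    then show ?thesis using R assms by (simp add: bellman_def)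
  next
    case False
    then have l: "f < sqrt l" "l > 0"
      using less_power2_iff_sqrt[of f l] le_less_trans[of 0 "f\<^sup>2" l] assms by auto
    define m where "m = l - d\<^sup>2"
    have B: "bellman f l = heat f l / Psi_ext 1" using False by (simp add: bellman_def)
    \<comment> \<open>The cases: \<open>l\<close> is exhausted by the step; both endpoints are
      inside the region; only the right one is outside; both are outside, on opposite sides.\<close>
    consider "m \<le> 0" | "0 < m" "f + d \<le> sqrt m" | "0 < m" "sqrt m < f + d" "d - f \<le> sqrt m"
      | "0 < m" "sqrt m < d - f" by linarith
    then show ?thesis
    proof cases
      case 1
      then have "sqrt l \<le> d" using assms by (auto simp: m_def intro: real_le_lsqrt)
      then show ?thesis using bellman_le_sqrt[of f l] l R assms by linarith
    next
      case 2
      then have "heat f l \<le> (heat (f + d) m + heat (f - d) m) / 2"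
        using assms unfolding m_def by (intro heat_midpoint_interior) auto
      then have "heat f l / Psi_ext 1 \<le> (heat (f + d) m / Psi_ext 1 + heat (f - d) m / Psi_ext 1) / 2"
        using Psi_ext_pos[of 1] by (simp add: field_simps)
      then show ?thesis
        using heat_le_bellman[OF 2(1), of "f + d"] heat_le_bellman[OF 2(1), of "f - d"]
        unfolding B m_def by argo
    next
      case 3
      \<comment> \<open>A left endpoint above \<open>sqrt m\<close> would force
        \<open>d <= f\<close> and \<open>m < (f - d)^2\<close>, hence
        \<open>l < f^2\<close>.\<close>
      have "f - d \<le> sqrt m"
      proof (rule ccontr)
        assume n: "\<not> f - d \<le> sqrt m"
        then have "(sqrt m)\<^sup>2 < (f - d)\<^sup>2" using 3 by (intro power_strict_mono) auto
        moreover have "d * d \<le> d * f"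
          using n 3 assms real_sqrt_ge_0_iff[of m] by (intro mult_left_mono) auto
        ultimately show False using 3 False by (simp add: m_def power2_eq_square algebra_simps)
      qed
      moreover have "(f - d)\<^sup>2 + 2 * (f - d) * d \<le> m"
        using False by (simp add: m_def power2_eq_square algebra_simps)
      ultimately have "heat (f - d + d) (m + d\<^sup>2) / Psi_ext 1
          \<le> (f - d + 2 * d + heat (f - d) m / Psi_ext 1) / 2"
        using 3 by (intro heat_midpoint_exit) auto
      then show ?thesis
        using heat_le_bellman[OF 3(1), of "f - d"] abs_le_bellman[of "f + d" m]
        unfolding B by (simp add: m_def)
    next
      case 4
      \<comment> \<open>A zero means \<open>(f - t)^2 = l - t^2\<close>. Shrinking \<open>d\<close>
        to the zero \<open>e\<close> puts the left endpoint on the boundary at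
        \<open>(- k, k^2)\<close>, and the exit inequality gives
        \<open>bellman f l <= e <= d <= ?R\<close>.\<close>
      let ?P = "\<lambda>t. 2 * t\<^sup>2 - 2 * f * t + f\<^sup>2 - l"
      have fd: "f \<le> d" using 4 real_sqrt_ge_0_iff[of m] by linarith
      have "(sqrt m)\<^sup>2 \<le> (d - f)\<^sup>2" using 4 by (intro power_mono) auto
      then have "0 \<le> ?P d" using 4 by (simp add: m_def power2_diff algebra_simps)
      moreover have "?P f \<le> 0" using False by (simp add: power2_eq_square)
      moreover have "continuous_on {f..d} ?P" by (intro continuous_intros)
      ultimately obtain e where e: "f \<le> e" "e \<le> d" "?P e = 0"
        using IVT'[of ?P f 0 d] fd by blast
      define k where "k = e - f"
      have "e \<noteq> f" using e False by (auto simp: power2_eq_square)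
      then have k: "0 < k" "k \<le> e" using e assms by (auto simp: k_def)
      have l_eq: "l = k\<^sup>2 + e\<^sup>2"
        using e(3) by (simp add: k_def power2_eq_square algebra_simps)
      have "heat (- k + e) (k\<^sup>2 + e\<^sup>2) / Psi_ext 1
          \<le> (- k + 2 * e + heat (- k) (k\<^sup>2) / Psi_ext 1) / 2"
      proof (rule heat_midpoint_exit)
        show "(- k)\<^sup>2 + 2 * - k * e \<le> k\<^sup>2" using k by simp
      qed (use k in auto)
      also have "heat (- k) (k\<^sup>2) / Psi_ext 1 = k"
        using k heat_diag[of "k\<^sup>2"] Psi_ext_pos[of 1] by simp
      also have "(- k + 2 * e + k) / 2 = e" by simp
      finally have "heat f l / Psi_ext 1 \<le> e" unfolding l_eq by (simp add: k_def)
      then show ?thesis using e(2) R(2) unfolding B by argo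
    qed
  qed
qed

text \<open>\<open>bellman\<close> is even in \<open>f\<close>, and changing the sign of
  \<open>d\<close> swaps the endpoints, so nonnegative \<open>f\<close> and \<open>d\<close>
  suffice.\<close>

lemma bellman_main:
  "bellman f l \<le> (bellman (f + d) (l - d\<^sup>2) + bellman (f - d) (l - d\<^sup>2)) / 2"
proof -
  have 1: "bellman f l \<le> (bellman (f + d) (l - d\<^sup>2) + bellman (f - d) (l - d\<^sup>2)) / 2"
    if "0 \<le> f" for f d
    using bellman_main_nonneg[OF that, of "\<bar>d\<bar>" l] by (cases "0 \<le> d") (auto simp: add.commute)
  show ?thesis
  proof (cases "0 \<le> f")
    case False
    have "bellman (- f + d) (l - d\<^sup>2) = bellman (f - d) (l - d\<^sup>2)"
      "bellman (- f - d) (l - d\<^sup>2) = bellman (f + d) (l - d\<^sup>2)"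
      using bellman_minus[of "f - d" "l - d\<^sup>2"] bellman_minus[of "f + d" "l - d\<^sup>2"] by simp_all
    then show ?thesis using 1[of "- f" d] False by simp
  qed (rule 1)
qed

section \<open>Dyadic intervals and the square function\<close>

definition dyint :: "int \<Rightarrow> int \<Rightarrow> real set" where
  "dyint m k = {of_int k * 2 powi m ..< of_int (k + 1) * 2 powi m}"

definition cell :: "int \<Rightarrow> real \<Rightarrow> real set" where
  "cell m x = dyint m \<lfloor>x / 2 powi m\<rfloor>"

lemma dyint_dyadic [simp]: "dyint m k \<in> dyadic"
  by (auto simp: dyint_def dyadic_def)

lemma dyadicE:
  assumes "J \<in> dyadic"
  obtains m k where "J = dyint m k"
  using assms by (auto simp: dyint_def dyadic_def)

lemma dyint_sets [measurable, simp]: "dyint m k \<in> sets borel" "dyint m k \<in> sets lebesgue"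
  by (auto simp: dyint_def)

lemma powi_half: "(2::real) powi m = 2 * 2 powi (m - 1)"
  using power_int_add_1'[of "2::real" "m - 1"] by simp

lemma measure_dyint [simp]: "measure lebesgue (dyint m k) = 2 powi m"
  by (simp add: dyint_def algebra_simps)

lemma emeasure_dyint: "emeasure lebesgue (dyint m k) = ennreal (2 powi m)"
  by (simp add: dyint_def algebra_simps)

lemma mem_dyint: "x \<in> dyint m k \<longleftrightarrow> \<lfloor>x / 2 powi m\<rfloor> = k"
  by (simp add: dyint_def floor_eq_iff pos_le_divide_eq pos_divide_less_eq)

lemma cell_eq: "x \<in> dyint m k \<Longrightarrow> cell m x = dyint m k"
  by (simp add: mem_dyint cell_def)

lemma mem_cell: "x \<in> cell m x"
  by (simp add: cell_def mem_dyint)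

lemma left_half_dyint: "left_half (dyint m k) = dyint (m - 1) (2 * k)"
  and right_half_dyint: "right_half (dyint m k) = dyint (m - 1) (2 * k + 1)"
proof -
  define p :: real where "p = 2 powi (m - 1)"
  have p: "p > 0" by (simp add: p_def)
  have "dyint m k = {2 * of_int k * p ..< (2 * of_int k + 2) * p}"
    unfolding dyint_def powi_half[of m] p_def by (simp add: algebra_simps)
  moreover have "2 * of_int k * p < (2 * of_int k + 2) * p" using p by simp
  ultimately have ends: "Inf (dyint m k) = 2 * of_int k * p" "Sup (dyint m k) = (2 * of_int k + 2) * p"
    by (simp_all only: cInf_atLeastLessThan cSup_atLeastLessThan)
  show "left_half (dyint m k) = dyint (m - 1) (2 * k)"
    "right_half (dyint m k) = dyint (m - 1) (2 * k + 1)"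
    unfolding left_half_def right_half_def ends
    by (simp_all add: dyint_def p_def[symmetric] algebra_simps add_divide_distrib)
qed

lemma dyint_split: "dyint m k = dyint (m - 1) (2 * k) \<union> dyint (m - 1) (2 * k + 1)"
proof -
  define p :: real where "p = 2 powi (m - 1)"
  have p: "p > 0" by (simp add: p_def)
  have "dyint m k = {2 * of_int k * p ..< (2 * of_int k + 2) * p}"
    unfolding dyint_def powi_half[of m] p_def by (simp add: algebra_simps)
  also have "\<dots> = {2 * of_int k * p ..< (2 * of_int k + 1) * p} \<union> {(2 * of_int k + 1) * p ..< (2 * of_int k + 2) * p}"
    using p by (intro ivl_disj_un_two(3)[symmetric]) auto
  also have "\<dots> = dyint (m - 1) (2 * k) \<union> dyint (m - 1) (2 * k + 1)"
    by (simp add: dyint_def p_def add.assoc)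
  finally show ?thesis .
qed

lemma dyint_disjoint: "j \<noteq> k \<Longrightarrow> dyint m j \<inter> dyint m k = {}"
  by (auto simp: mem_dyint)

lemma cell_antimono: "cell (m - int n) x \<subseteq> cell m x"
proof (induction n)
  case (Suc n)
  have "cell (k - 1) x \<subseteq> cell k x" for k
  proof -
    have "x \<in> dyint (k - 1) (2 * \<lfloor>x / 2 powi k\<rfloor>) \<union> dyint (k - 1) (2 * \<lfloor>x / 2 powi k\<rfloor> + 1)"
      using mem_cell[of x k] unfolding cell_def dyint_split[symmetric] .
    then show ?thesis
      using cell_eq[of x "k - 1"] unfolding cell_def[of k] dyint_split[of k] by blast
  qed
  from this[of "m - int n"] Suc show ?case by (simp add: algebra_simps)
qed simp

lemma measure_cell [simp]: "measure lebesgue (cell m x) = 2 powi m"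
  by (simp add: cell_def)

lemma powi_le_iff [simp]: "(2::real) powi m \<le> 2 powi n \<longleftrightarrow> m \<le> n"
  using power_int_strict_increasing[of n m "2::real"] power_int_increasing[of m n "2::real"]
  by (meson linorder_not_less one_le_numeral one_less_numeral_iff semiring_norm(76))

lemma powi_eq_iff [simp]: "(2::real) powi m = 2 powi n \<longleftrightarrow> m = n"
  by (simp add: order_eq_iff)

text \<open>Comparing measures bounds the scale of \<open>I\<close> by \<open>m\<close>, and scale
  and point determine the interval. The sum in \<open>sq_fun2\<close> at \<open>x\<close> thus
  becomes a series over generations.\<close>

lemma dyadic_containing:
  assumes "x \<in> dyint m k"
  shows "{I \<in> dyadic. I \<subseteq> dyint m k \<and> x \<in> I} = range (\<lambda>n. cell (m - int n) x)"
proof (intro equalityI subsetI)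
  fix I assume "I \<in> {I \<in> dyadic. I \<subseteq> dyint m k \<and> x \<in> I}"
  then obtain i j where I: "I = dyint i j" "I \<subseteq> dyint m k" "x \<in> I"
    by (auto elim: dyadicE)
  have "dyint m k \<in> fmeasurable lebesgue"
    using emeasure_dyint[of m k] by (intro fmeasurableI) auto
  then have "measure lebesgue I \<le> measure lebesgue (dyint m k)"
    using I by (intro measure_mono_fmeasurable) auto
  then have "i \<le> m" using I by simp
  then have "I = cell (m - int (nat (m - i))) x"
    using I by (simp add: cell_eq)
  then show "I \<in> range (\<lambda>n. cell (m - int n) x)" by blast
next
  fix I assume "I \<in> range (\<lambda>n. cell (m - int n) x)"
  then obtain n where I: "I = cell (m - int n) x" by blast
  have "I \<subseteq> dyint m k"
    using cell_antimono[of m n x] cell_eq[OF assms] by (simp add: I)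
  then show "I \<in> {I \<in> dyadic. I \<subseteq> dyint m k \<and> x \<in> I}"
    using mem_cell by (simp add: I) (simp add: cell_def)
qed

section \<open>The square function as a series over generations\<close>

text \<open>This is the step \<open>d\<close> of the main inequality when an interval is
  split.\<close>

definition half_diff :: "(real \<Rightarrow> real) \<Rightarrow> real set \<Rightarrow> real" where
  "half_diff \<phi> I = (avg \<phi> (right_half I) - avg \<phi> (left_half I)) / 2"

definition sq_term :: "(real \<Rightarrow> real) \<Rightarrow> int \<Rightarrow> real \<Rightarrow> nat \<Rightarrow> real" where
  "sq_term \<phi> m x n = (half_diff \<phi> (cell (m - int n) x))\<^sup>2"

lemma sq_term_nonneg [simp]: "0 \<le> sq_term \<phi> m x n"
  by (simp add: sq_term_def)

lemma mdiff_sq: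
  assumes "x \<in> dyint m k"
  shows "(mdiff (dyint m k) \<phi> x)\<^sup>2 = (half_diff \<phi> (dyint m k))\<^sup>2"
proof -
  have "indicator (right_half (dyint m k)) x - indicator (left_half (dyint m k)) x \<in> {1, - 1 :: real}"
    using assms dyint_disjoint[of "2 * k" "2 * k + 1" "m - 1"] unfolding left_half_dyint right_half_dyint
    by (subst (asm) dyint_split) (auto simp: indicator_def)
  then show ?thesis
    by (auto simp: mdiff_def half_diff_def power2_commute power_divide)
qed

text \<open>Intervals missing \<open>x\<close> contribute 0; the others are the nested cells around
  \<open>x\<close>, listed without repetition because their lengths differ.\<close>

lemma sq_fun2_eq_suminf:
  assumes "x \<in> dyint m k"
  shows "sq_fun2 (dyint m k) \<phi> x = (\<Sum>n. ennreal (sq_term \<phi> m x n))"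
proof -
  let ?u = "\<lambda>I. ennreal (\<bar>mdiff I \<phi> x\<bar>\<^sup>2 * indicator I x)"
  let ?c = "\<lambda>n. cell (m - int n) x"
  have inj: "inj ?c"
  proof (rule injI)
    fix i j assume "?c i = ?c j"
    then have "measure lebesgue (?c i) = measure lebesgue (?c j)" by simp
    then show "i = j" by simp
  qed
  have "sq_fun2 (dyint m k) \<phi> x = infsum ?u {I \<in> dyadic. I \<subseteq> dyint m k \<and> x \<in> I}"
    unfolding sq_fun2_def by (rule infsum_cong_neutral) auto
  also have "\<dots> = infsum (?u \<circ> ?c) UNIV"
    unfolding dyadic_containing[OF assms] by (rule infsum_reindex[OF inj])
  also have "?u \<circ> ?c = (\<lambda>n. ennreal (sq_term \<phi> m x n))"
  proof
    fix n
    have "x \<in> ?c n" by (rule mem_cell)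
    then show "(?u \<circ> ?c) n = ennreal (sq_term \<phi> m x n)"
      unfolding cell_def by (simp add: mdiff_sq sq_term_def cell_eq)
  qed
  also have "infsum (\<lambda>n. ennreal (sq_term \<phi> m x n)) UNIV = (\<Sum>n. ennreal (sq_term \<phi> m x n))"
    by (intro sums_unique has_sum_imp_sums has_sum_infsum nonneg_summable_on_complete) simp
  finally show ?thesis .
qed

definition sq_part :: "(real \<Rightarrow> real) \<Rightarrow> int \<Rightarrow> nat \<Rightarrow> real \<Rightarrow> real" where
  "sq_part \<phi> m n x = (\<Sum>i<n. sq_term \<phi> m x i)"

lemma sq_part_0 [simp]: "sq_part \<phi> m 0 x = 0"
  by (simp add: sq_part_def)

lemma sq_part_nonneg: "0 \<le> sq_part \<phi> m n x"
  by (simp add: sq_part_def sum_nonneg)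

text \<open>Counting generations from the next finer scale shifts the index by one. Both recursions
  below, for partial sums and for \<open>sq_fun2\<close>, rest on this.\<close>

lemma sq_term_Suc: "sq_term \<phi> m x (Suc n) = sq_term \<phi> (m - 1) x n"
  by (simp add: sq_term_def algebra_simps)

lemma sq_part_Suc:
  "x \<in> dyint m k \<Longrightarrow> sq_part \<phi> m (Suc n) x = (half_diff \<phi> (dyint m k))\<^sup>2 + sq_part \<phi> (m - 1) n x"
  unfolding sq_part_def sum.lessThan_Suc_shift
  by (simp add: sq_term_Suc) (simp add: sq_term_def cell_eq)

lemma sq_fun2_step:
  assumes "x \<in> dyint m k" "x \<in> dyint (m - 1) j"
  shows "sq_fun2 (dyint m k) \<phi> x
    = ennreal ((half_diff \<phi> (dyint m k))\<^sup>2) + sq_fun2 (dyint (m - 1) j) \<phi> x"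
proof -
  have "(\<lambda>n. ennreal (sq_term \<phi> m x (Suc n))) sums (\<Sum>n. ennreal (sq_term \<phi> (m - 1) x n))"
    by (simp add: sq_term_Suc summable_sums)
  from sums_Suc[OF this] show ?thesis
    unfolding sq_fun2_eq_suminf[OF assms(1)] sq_fun2_eq_suminf[OF assms(2)]
    using assms(1) by (simp add: sums_iff add.commute) (simp add: sq_term_def cell_eq)
qed

lemma sq_part_measurable [measurable]: "sq_part \<phi> m n \<in> borel_measurable lebesgue"
proof -
  have "(\<lambda>x. half_diff \<phi> (cell i x)) \<in> borel_measurable borel" for i
  proof -
    \<comment> \<open>The cell depends on \<open>x\<close> only through an integer, and every map
      from a discrete space is measurable.\<close>
    have "(\<lambda>x :: real. \<lfloor>x / 2 powi i\<rfloor>) \<in> borel \<rightarrow>\<^sub>M count_space UNIV" by measurable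
    from measurable_compose[OF this, of "\<lambda>k. half_diff \<phi> (dyint i k)"]
    show ?thesis by (simp add: cell_def)
  qed
  then have "sq_part \<phi> m n \<in> borel_measurable borel"
    unfolding sq_part_def[abs_def] sq_term_def by measurable
  then show ?thesis by (simp add: measurable_completion)
qed

text \<open>The partial sums may tend to infinity, so the convergence is proved by order bounds and
  not by subtracting limits.\<close>

lemma sq_part_tendsto:
  assumes "x \<in> dyint m k" "ennreal l \<le> sq_fun2 (dyint m k) \<phi> x"
  shows "(\<lambda>n. sqrt (max 0 (l - sq_part \<phi> m n x))) \<longlonglongrightarrow> 0"
proof -
  have lim: "(\<lambda>n. ennreal (sq_part \<phi> m n x)) \<longlonglongrightarrow> sq_fun2 (dyint m k) \<phi> x"
  proof -
    have "(\<lambda>n. \<Sum>i<n. ennreal (sq_term \<phi> m x i)) \<longlonglongrightarrow> (\<Sum>i. ennreal (sq_term \<phi> m x i))"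
      by (intro summable_LIMSEQ summableI)
    moreover have "(\<Sum>i<n. ennreal (sq_term \<phi> m x i)) = ennreal (sq_part \<phi> m n x)" for n
      unfolding sq_part_def by (rule sum_ennreal) simp
    ultimately show ?thesis by (simp only: sq_fun2_eq_suminf[OF assms(1)])
  qed
  have "(\<lambda>n. max 0 (l - sq_part \<phi> m n x)) \<longlonglongrightarrow> 0"
  proof (rule order_tendstoI)
    fix e :: real assume e: "0 < e"
    show "\<forall>\<^sub>F n in sequentially. max 0 (l - sq_part \<phi> m n x) < e"
    \<comment> \<open>\<open>ennreal\<close> sends negative numbers to 0, so the strict comparison
      needs \<open>l - e\<close> nonnegative.\<close>
    proof (cases "l - e < 0")
      case True
      have "max 0 (l - sq_part \<phi> m n x) < e" for n
        using True e sq_part_nonneg[of \<phi> m n x] by simp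
      then show ?thesis by simp
    next
      case False
      then have "ennreal (l - e) < ennreal l" using e by (simp add: ennreal_less_iff)
      also note assms(2)
      finally have "\<forall>\<^sub>F n in sequentially. ennreal (l - e) < ennreal (sq_part \<phi> m n x)"
        by (rule order_tendstoD[OF lim])
      then show ?thesis
      proof eventually_elim
        case (elim n)
        then have "l - e < sq_part \<phi> m n x" using False by (simp add: ennreal_less_iff)
        then show ?case using e by simp
      qed
    qed
  next
    fix e :: real assume "e < 0"
    then show "\<forall>\<^sub>F n in sequentially. e < max 0 (l - sq_part \<phi> m n x)"
      by (simp add: less_max_iff_disj)
  qed
  from tendsto_real_sqrt[OF this] show ?thesis by (simp only: real_sqrt_zero)
qed

lemma integrable_dyint:
  assumes "integrable lebesgue (\<phi> :: real \<Rightarrow> real)"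
  shows "set_integrable lebesgue (dyint m k) \<phi>"
  unfolding set_integrable_def using assms by (intro integrable_mult_indicator) auto

lemma set_integral_dyint_split:
  fixes g :: "real \<Rightarrow> real"
  assumes "set_integrable lebesgue (dyint m k) g"
  shows "(LINT x:dyint m k|lebesgue. g x) = (LINT x:dyint (m - 1) (2 * k)|lebesgue. g x)
    + (LINT x:dyint (m - 1) (2 * k + 1)|lebesgue. g x)"
proof -
  have "set_integrable lebesgue (dyint (m - 1) (2 * k)) g"
    "set_integrable lebesgue (dyint (m - 1) (2 * k + 1)) g"
    by (auto intro!: set_integrable_subset[OF assms] simp: dyint_split[of m k])
  then show ?thesis
    unfolding dyint_split[of m k] by (intro set_integral_Un dyint_disjoint) auto
qed

lemma avg_halves:
  assumes "set_integrable lebesgue (dyint m k) \<phi>"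
  shows "avg \<phi> (dyint (m - 1) (2 * k)) = avg \<phi> (dyint m k) - half_diff \<phi> (dyint m k)"
    and "avg \<phi> (dyint (m - 1) (2 * k + 1)) = avg \<phi> (dyint m k) + half_diff \<phi> (dyint m k)"
proof -
  have "avg \<phi> (dyint m k) = (avg \<phi> (dyint (m - 1) (2 * k)) + avg \<phi> (dyint (m - 1) (2 * k + 1))) / 2"
    using set_integral_dyint_split[OF assms]
    by (simp add: avg_def powi_half[of m] add_divide_distrib)
  then show "avg \<phi> (dyint (m - 1) (2 * k)) = avg \<phi> (dyint m k) - half_diff \<phi> (dyint m k)"
    "avg \<phi> (dyint (m - 1) (2 * k + 1)) = avg \<phi> (dyint m k) + half_diff \<phi> (dyint m k)"
    by (simp_all add: half_diff_def left_half_dyint right_half_dyint field_simps)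
qed

lemma integrable_defect:
  "set_integrable lebesgue (dyint m k) (\<lambda>x. sqrt (max 0 (l - sq_part \<phi> m' n x)))"
proof -
  have "integrable lebesgue (\<lambda>x. indicator (dyint m k) x *\<^sub>R sqrt (max 0 l))"
    by (intro integrable_scaleR_left integrable_real_indicator) (auto simp: emeasure_dyint)
  then show ?thesis
    unfolding set_integrable_def
  proof (rule Bochner_Integration.integrable_bound)
    show "(\<lambda>x. indicator (dyint m k) x *\<^sub>R sqrt (max 0 (l - sq_part \<phi> m' n x))) \<in> borel_measurable lebesgue"
      by measurable
    have "max 0 (l - sq_part \<phi> m' n x) \<le> max 0 l" for x
      using sq_part_nonneg[of \<phi> m' n x] by (simp add: max_def)
    then show "AE x in lebesgue. norm (indicator (dyint m k) x *\<^sub>R sqrt (max 0 (l - sq_part \<phi> m' n x)))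
        \<le> norm (indicator (dyint m k) x *\<^sub>R sqrt (max 0 l))"
      by (intro always_eventually) (auto simp: indicator_def)
  qed
qed

section \<open>The lower bound\<close>

text \<open>Induction on the number of generations: each half is treated with
  \<open>l - ?d^2\<close> in place of \<open>l\<close>, hence the generalization over
  \<open>m\<close>, \<open>k\<close> and \<open>l\<close>. The start uses
  \<open>bellman_le\<close>.\<close>

lemma bellman_le_integral_defect:
  assumes \<phi>: "integrable lebesgue (\<phi> :: real \<Rightarrow> real)"
  shows "2 powi m * bellman (avg \<phi> (dyint m k)) l
    \<le> (LINT x:dyint m k|lebesgue. \<bar>\<phi> x\<bar> + sqrt (max 0 (l - sq_part \<phi> m n x)))"
proof (induction n arbitrary: m k l)
  case 0
  let ?J = "dyint m k"
  have i: "set_integrable lebesgue ?J \<phi>" by (rule integrable_dyint[OF \<phi>])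
  have c: "set_integrable lebesgue ?J (\<lambda>x. sqrt (max 0 l))"
    using integrable_defect[of m k l \<phi> m 0] by simp
  have "\<bar>LINT x:?J|lebesgue. \<phi> x\<bar> \<le> (LINT x:?J|lebesgue. \<bar>\<phi> x\<bar>)"
    using set_integral_norm_bound[OF i] by simp
  moreover have "(LINT x:?J|lebesgue. \<phi> x) = 2 powi m * avg \<phi> ?J"
    by (simp add: avg_def)
  ultimately have "2 powi m * \<bar>avg \<phi> ?J\<bar> \<le> (LINT x:?J|lebesgue. \<bar>\<phi> x\<bar>)"
    by (simp add: abs_mult)
  moreover have "(LINT x:?J|lebesgue. sqrt (max 0 l)) = 2 powi m * sqrt (max 0 l)"
    by (subst set_integral_const) (auto simp: emeasure_dyint)
  moreover have "2 powi m * bellman (avg \<phi> ?J) l \<le> 2 powi m * (\<bar>avg \<phi> ?J\<bar> + sqrt (max 0 l))"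
    by (intro mult_left_mono bellman_le) simp
  ultimately show ?case
    using set_integral_add(2)[OF set_integrable_abs[OF i] c] by (simp add: distrib_left)
next
  case (Suc n)
  let ?J = "dyint m k" and ?L = "dyint (m - 1) (2 * k)" and ?R = "dyint (m - 1) (2 * k + 1)"
  let ?d = "half_diff \<phi> ?J"
  let ?g = "\<lambda>x. \<bar>\<phi> x\<bar> + sqrt (max 0 (l - sq_part \<phi> m (Suc n) x))"
  let ?h = "\<lambda>x. \<bar>\<phi> x\<bar> + sqrt (max 0 (l - ?d\<^sup>2 - sq_part \<phi> (m - 1) n x))"
  have i: "set_integrable lebesgue (dyint m k) \<phi>" for m k by (rule integrable_dyint[OF \<phi>])
  have g: "set_integrable lebesgue ?J ?g"
    by (intro set_integral_add(1) set_integrable_abs i integrable_defect)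
  \<comment> \<open>The term of \<open>?J\<close> itself is moved into \<open>l\<close>, and the
    remaining ones are counted from the next finer scale.\<close>
  have gh: "?g x = ?h x" if "x \<in> ?J" for x
    using sq_part_Suc[OF that, of \<phi> n] by (simp add: diff_diff_eq)
  have sub: "?L \<subseteq> ?J" "?R \<subseteq> ?J" by (auto simp: dyint_split[of m k])
  have "2 powi m * bellman (avg \<phi> ?J) l \<le> 2 powi m * ((bellman (avg \<phi> ?J + ?d) (l - ?d\<^sup>2)
      + bellman (avg \<phi> ?J - ?d) (l - ?d\<^sup>2)) / 2)"
    by (intro mult_left_mono bellman_main) simp
  also have "\<dots> = 2 powi (m - 1) * bellman (avg \<phi> ?L) (l - ?d\<^sup>2)
      + 2 powi (m - 1) * bellman (avg \<phi> ?R) (l - ?d\<^sup>2)"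
    using i[of m k] by (simp add: avg_halves powi_half[of m] distrib_left)
  also have "\<dots> \<le> (LINT x:?L|lebesgue. ?h x) + (LINT x:?R|lebesgue. ?h x)"
    by (intro add_mono Suc)
  also have "(LINT x:?L|lebesgue. ?h x) = (LINT x:?L|lebesgue. ?g x)"
    using sub gh by (intro set_lebesgue_integral_cong) auto
  also have "(LINT x:?R|lebesgue. ?h x) = (LINT x:?R|lebesgue. ?g x)"
    using sub gh by (intro set_lebesgue_integral_cong) auto
  also have "(LINT x:?L|lebesgue. ?g x) + (LINT x:?R|lebesgue. ?g x) = (LINT x:?J|lebesgue. ?g x)"
    by (rule set_integral_dyint_split[OF g, symmetric])
  finally show ?case .
qed

lemma bellman_le_avg_abs:
  assumes \<phi>: "integrable lebesgue (\<phi> :: real \<Rightarrow> real)"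
    and sq: "AE x in lebesgue. x \<in> dyint m k \<longrightarrow> ennreal l \<le> sq_fun2 (dyint m k) \<phi> x"
  shows "bellman (avg \<phi> (dyint m k)) l \<le> avg (\<lambda>x. \<bar>\<phi> x\<bar>) (dyint m k)"
proof -
  let ?J = "dyint m k"
  define e where "e n x = indicator ?J x *\<^sub>R sqrt (max 0 (l - sq_part \<phi> m n x))" for n x
  have i: "set_integrable lebesgue ?J (\<lambda>x. \<bar>\<phi> x\<bar>)"
    by (intro set_integrable_abs integrable_dyint[OF \<phi>])
  have "(\<lambda>n. integral\<^sup>L lebesgue (e n)) \<longlonglongrightarrow> integral\<^sup>L lebesgue (\<lambda>x :: real. 0)"
  \<comment> \<open>Partial sums are nonnegative, so the initial defect \<open>e 0\<close> dominates
    all later ones.\<close>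
  proof (rule integral_dominated_convergence[where w = "e 0"])
    show "AE x in lebesgue. (\<lambda>n. e n x) \<longlonglongrightarrow> 0"
      using sq
    proof eventually_elim
      case (elim x)
      then show ?case using sq_part_tendsto[of x m k l \<phi>] by (cases "x \<in> ?J") (auto simp: e_def)
    qed
    show int_e: "integrable lebesgue (e n)" for n
      using integrable_defect[of m k l \<phi> m n] by (simp add: set_integrable_def e_def[abs_def])
    then show "e n \<in> borel_measurable lebesgue" for n by (rule borel_measurable_integrable)
    have "max 0 (l - sq_part \<phi> m n x) \<le> max 0 l" for n x
      using sq_part_nonneg[of \<phi> m n x] by (simp add: max_def)
    then show "AE x in lebesgue. norm (e n x) \<le> e 0 x" for n
      by (intro always_eventually) (auto simp: indicator_def e_def)
  qed simp
  then have "(\<lambda>n. (LINT x:?J|lebesgue. \<bar>\<phi> x\<bar>)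
      + (LINT x:?J|lebesgue. sqrt (max 0 (l - sq_part \<phi> m n x))))
      \<longlonglongrightarrow> (LINT x:?J|lebesgue. \<bar>\<phi> x\<bar>) + 0"
    by (intro tendsto_add tendsto_const) (simp add: set_lebesgue_integral_def e_def[abs_def])
  moreover have "\<forall>n. 2 powi m * bellman (avg \<phi> ?J) l \<le> (LINT x:?J|lebesgue. \<bar>\<phi> x\<bar>)
      + (LINT x:?J|lebesgue. sqrt (max 0 (l - sq_part \<phi> m n x)))"
    using bellman_le_integral_defect[OF \<phi>] set_integral_add(2)[OF i integrable_defect] by metis
  ultimately have "2 powi m * bellman (avg \<phi> ?J) l \<le> (LINT x:?J|lebesgue. \<bar>\<phi> x\<bar>) + 0"
    by (intro LIMSEQ_le_const) auto
  then show ?thesis by (simp add: avg_def field_simps)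
qed

section \<open>The upper bound\<close>

text \<open>Quantifying over all dyadic intervals at once lets two witnesses on the halves be glued.\<close>

definition attains :: "real \<Rightarrow> real \<Rightarrow> real \<Rightarrow> bool" where
  "attains f l v \<longleftrightarrow> (\<forall>m k. \<exists>\<phi>. integrable_supported (dyint m k) \<phi> \<and> avg \<phi> (dyint m k) = f \<and>
     (\<forall>x\<in>dyint m k. ennreal l \<le> sq_fun2 (dyint m k) \<phi> x) \<and> avg (\<lambda>x. \<bar>\<phi> x\<bar>) (dyint m k) \<le> v)"

lemma attains_mono: "attains f l v \<Longrightarrow> v \<le> w \<Longrightarrow> attains f l w"
  unfolding attains_def by (meson order_trans)

lemma avg_cong:
  assumes "\<And>x. x \<in> dyint m k \<Longrightarrow> \<phi> x = \<psi> x"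
  shows "avg \<phi> (dyint m k) = avg \<psi> (dyint m k)"
  using assms by (auto simp: avg_def intro!: set_lebesgue_integral_cong)

lemma avg_const: "avg (\<lambda>x. c) (dyint m k) = c"
  unfolding avg_def by (subst set_integral_const) (auto simp: emeasure_dyint)

text \<open>All intervals in the sum lie in \<open>dyint m k\<close>, so only values there enter. A
  glued function can then be evaluated on each half separately.\<close>

lemma sq_fun2_cong:
  assumes "x \<in> dyint m k" "\<And>x. x \<in> dyint m k \<Longrightarrow> \<phi> x = \<psi> x"
  shows "sq_fun2 (dyint m k) \<phi> x = sq_fun2 (dyint m k) \<psi> x"
proof -
  have "half_diff \<phi> (cell (m - int n) x) = half_diff \<psi> (cell (m - int n) x)" for n
  proof -
    define i j where "i = m - int n" and "j = \<lfloor>x / 2 powi i\<rfloor>"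
    have c: "cell (m - int n) x = dyint i j" by (simp add: i_def j_def cell_def)
    have "dyint i j \<subseteq> dyint m k"
      using cell_antimono[of m n x] unfolding c cell_eq[OF assms(1)] .
    then have "\<phi> y = \<psi> y" if "y \<in> dyint (i - 1) (2 * j) \<union> dyint (i - 1) (2 * j + 1)" for y
      using assms(2) that dyint_split[of i j] by blast
    then show ?thesis
      unfolding c half_diff_def left_half_dyint right_half_dyint
      by (intro arg_cong2[where f = "\<lambda>a b. (a - b) / 2"] avg_cong) auto
  qed
  then show ?thesis by (simp add: sq_fun2_eq_suminf[OF assms(1)] sq_term_def)
qed

lemma attains_nonpos:
  assumes "l \<le> 0"
  shows "attains f l \<bar>f\<bar>"
  unfolding attains_def
proof (intro allI)
  fix m k
  let ?\<phi> = "\<lambda>x. f * indicator (dyint m k) x"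
  have "integrable lebesgue ?\<phi>"
    by (intro integrable_mult_right integrable_real_indicator) (auto simp: emeasure_dyint)
  then have "integrable_supported (dyint m k) ?\<phi>"
    by (auto simp: integrable_supported_def)
  moreover have "avg ?\<phi> (dyint m k) = f" "avg (\<lambda>x. \<bar>?\<phi> x\<bar>) (dyint m k) = \<bar>f\<bar>"
    using avg_cong[of m k ?\<phi> "\<lambda>x. f"] avg_cong[of m k "\<lambda>x. \<bar>?\<phi> x\<bar>" "\<lambda>x. \<bar>f\<bar>"]
    by (auto simp: avg_const)
  ultimately show "\<exists>\<phi>. integrable_supported (dyint m k) \<phi> \<and> avg \<phi> (dyint m k) = f \<and>
     (\<forall>x\<in>dyint m k. ennreal l \<le> sq_fun2 (dyint m k) \<phi> x) \<and> avg (\<lambda>x. \<bar>\<phi> x\<bar>) (dyint m k) \<le> \<bar>f\<bar>"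
    using assms by (intro exI[of _ ?\<phi>]) (auto simp: ennreal_neg)
qed

text \<open>The witness for \<open>f + d\<close> is placed on the right half and the one for
  \<open>f - d\<close> on the left; the top interval then adds exactly \<open>d^2\<close> to the
  square function.\<close>

lemma attains_step:
  assumes "attains (f + d) (l - d\<^sup>2) v" "attains (f - d) (l - d\<^sup>2) w"
  shows "attains f l ((v + w) / 2)"
  unfolding attains_def
proof (intro allI)
  fix m k
  let ?J = "dyint m k" and ?L = "dyint (m - 1) (2 * k)" and ?R = "dyint (m - 1) (2 * k + 1)"
  obtain \<psi> where \<psi>: "integrable_supported ?R \<psi>" "avg \<psi> ?R = f + d"
    "\<forall>x\<in>?R. ennreal (l - d\<^sup>2) \<le> sq_fun2 ?R \<psi> x" "avg (\<lambda>x. \<bar>\<psi> x\<bar>) ?R \<le> v"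
    using assms(1) unfolding attains_def by blast
  obtain \<xi> where \<xi>: "integrable_supported ?L \<xi>" "avg \<xi> ?L = f - d"
    "\<forall>x\<in>?L. ennreal (l - d\<^sup>2) \<le> sq_fun2 ?L \<xi> x" "avg (\<lambda>x. \<bar>\<xi> x\<bar>) ?L \<le> w"
    using assms(2) unfolding attains_def by blast
  define \<phi> where "\<phi> x = \<psi> x + \<xi> x" for x
  have disj: "?L \<inter> ?R = {}" by (intro dyint_disjoint) simp
  have R: "\<phi> x = \<psi> x" if "x \<in> ?R" for x
    using that disj \<xi>(1) by (auto simp: \<phi>_def integrable_supported_def)
  have L: "\<phi> x = \<xi> x" if "x \<in> ?L" for x
    using that disj \<psi>(1) by (auto simp: \<phi>_def integrable_supported_def)
  have int: "integrable lebesgue \<phi>"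
    using \<psi>(1) \<xi>(1) unfolding integrable_supported_def \<phi>_def[abs_def] by auto
  have supp: "integrable_supported ?J \<phi>"
    using int \<psi>(1) \<xi>(1) by (auto simp: integrable_supported_def \<phi>_def dyint_split[of m k])
  have avgs: "avg \<phi> ?R = f + d" "avg \<phi> ?L = f - d"
    "avg (\<lambda>x. \<bar>\<phi> x\<bar>) ?R \<le> v" "avg (\<lambda>x. \<bar>\<phi> x\<bar>) ?L \<le> w"
    using avg_cong[of _ _ \<phi> \<psi>, OF R] avg_cong[of _ _ \<phi> \<xi>, OF L] \<psi> \<xi>
      avg_cong[of "m - 1" "2 * k + 1" "\<lambda>x. \<bar>\<phi> x\<bar>" "\<lambda>x. \<bar>\<psi> x\<bar>"]
      avg_cong[of "m - 1" "2 * k" "\<lambda>x. \<bar>\<phi> x\<bar>" "\<lambda>x. \<bar>\<xi> x\<bar>"] R L by auto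
  have hd: "half_diff \<phi> ?J = d"
    by (simp add: half_diff_def left_half_dyint right_half_dyint avgs)
  have "avg \<phi> ?J = f"
    using avg_halves(2)[OF integrable_dyint[OF int], of m k] by (simp add: hd avgs)
  moreover have "avg (\<lambda>x. \<bar>\<phi> x\<bar>) ?J \<le> (v + w) / 2"
    using avg_halves[OF set_integrable_abs[OF integrable_dyint[OF int]], of m k] avgs by simp
  moreover have "ennreal l \<le> sq_fun2 ?J \<phi> x" if x: "x \<in> ?J" for x
  proof -
    have "\<exists>j. x \<in> dyint (m - 1) j \<and> ennreal (l - d\<^sup>2) \<le> sq_fun2 (dyint (m - 1) j) \<phi> x"
    proof (cases "x \<in> ?R")
      case True
      then show ?thesis using \<psi>(3) sq_fun2_cong[OF True R] by auto
    next
      case False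
      then have "x \<in> ?L" using x dyint_split[of m k] by blast
      then show ?thesis using \<xi>(3) sq_fun2_cong[OF _ L] by auto
    qed
    then obtain j where j: "x \<in> dyint (m - 1) j" "ennreal (l - d\<^sup>2) \<le> sq_fun2 (dyint (m - 1) j) \<phi> x"
      by blast
    \<comment> \<open>The \<open>max\<close> handles a negative \<open>l - d^2\<close>, which
      \<open>ennreal\<close> maps to 0.\<close>
    have "ennreal l \<le> ennreal (d\<^sup>2 + max 0 (l - d\<^sup>2))" by (intro ennreal_leI) simp
    also have "\<dots> = ennreal (d\<^sup>2) + ennreal (l - d\<^sup>2)"
      by (subst ennreal_plus) (auto simp: max_def ennreal_neg)
    also have "\<dots> \<le> ennreal (d\<^sup>2) + sq_fun2 (dyint (m - 1) j) \<phi> x"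
      using j by (intro add_left_mono)
    also have "\<dots> = sq_fun2 ?J \<phi> x"
      using sq_fun2_step[OF x j(1), of \<phi>] by (simp add: hd)
    finally show ?thesis .
  qed
  ultimately show "\<exists>\<phi>. integrable_supported ?J \<phi> \<and> avg \<phi> ?J = f \<and>
     (\<forall>x\<in>?J. ennreal l \<le> sq_fun2 ?J \<phi> x) \<and> avg (\<lambda>x. \<bar>\<phi> x\<bar>) ?J \<le> (v + w) / 2"
    using supp by blast
qed

text \<open>A split with \<open>d = f\<close> gives the values \<open>2 * f\<close> and 0, of one
  sign, while its single term \<open>f^2\<close> already reaches \<open>l\<close>.\<close>

lemma attains_above:
  assumes "0 < l" "sqrt l \<le> \<bar>f\<bar>"
  shows "attains f l \<bar>f\<bar>"
proof -
  have "l \<le> f\<^sup>2" using assms less_power2_iff_sqrt[of f l] by linarith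
  then have "attains f l ((\<bar>f + f\<bar> + \<bar>f - f\<bar>) / 2)"
    by (intro attains_step[of f f] attains_nonpos) auto
  then show ?thesis by (simp add: abs_mult flip: mult_2)
qed

text \<open>A split with \<open>d = sqrt l\<close> spends \<open>l\<close> at once; the two values
  straddle 0, so their absolute values average to \<open>sqrt l\<close>.\<close>

lemma attains_sqrt:
  assumes "0 < l" "\<bar>f\<bar> \<le> sqrt l"
  shows "attains f l (sqrt l)"
proof -
  have "attains f l ((\<bar>f + sqrt l\<bar> + \<bar>f - sqrt l\<bar>) / 2)"
    using assms by (intro attains_step[of f "sqrt l"] attains_nonpos) auto
  moreover have "(\<bar>f + sqrt l\<bar> + \<bar>f - sqrt l\<bar>) / 2 = sqrt l"
    using assms by (auto simp: abs_if split: if_splits)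
  ultimately show ?thesis by simp
qed

text \<open>Each step lowers \<open>l\<close> by \<open>d^2\<close> and loses at most
  \<open>\<eta> * d^2\<close>, which the decrease of \<open>\<eta> * l\<close> pays for. The term
  \<open>2 * d\<close> covers the overshoot past the boundary, and \<open>sqrt e\<close> the stop at
  small \<open>l\<close>. The number \<open>n\<close> bounds the steps that remain.\<close>

lemma attains_heat_approx:
  assumes e: "0 < e" and \<eta>: "0 < \<eta>" and d: "0 < d" "2 * d\<^sup>2 \<le> e" "4 * d \<le> \<eta> * e"
  shows "\<lbrakk>0 < l; l \<le> e + real n * d\<^sup>2; \<bar>f\<bar> \<le> sqrt l + 2 * d\<rbrakk>
    \<Longrightarrow> attains f l (heat f l / Psi_ext 1 + \<eta> * l + (2 * d + sqrt e))"
proof (induction n arbitrary: f l)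
  \<comment> \<open>The stopped states: \<open>attains_above\<close> outside the region,
    \<open>attains_sqrt\<close> when \<open>l <= e\<close>.\<close>
  have small: "attains f l (heat f l / Psi_ext 1 + \<eta> * l + (2 * d + sqrt e))"
    if l: "0 < l" "\<bar>f\<bar> \<le> sqrt l + 2 * d" "sqrt l \<le> \<bar>f\<bar> \<or> l \<le> e" for f l
  proof -
    have h: "0 \<le> heat f l / Psi_ext 1" using heat_nonneg Psi_ext_pos[of 1] l by simp
    have \<eta>l: "0 \<le> \<eta> * l" "0 \<le> sqrt e" using \<eta> e l by auto
    show ?thesis
    proof (cases "sqrt l \<le> \<bar>f\<bar>")
      case True
      have "heat (sqrt l) l \<le> heat f l" using True l by (intro heat_mono) auto
      then have "sqrt l \<le> heat f l / Psi_ext 1"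
        using heat_diag[OF l(1)] Psi_ext_pos[of 1] by (simp add: le_divide_eq)
      then have "\<bar>f\<bar> \<le> heat f l / Psi_ext 1 + \<eta> * l + (2 * d + sqrt e)"
        using l(2) \<eta>l by linarith
      then show ?thesis using attains_mono[OF attains_above[OF l(1) True]] by blast
    next
      case False
      then have "sqrt l \<le> sqrt e" using l by simp
      then have "sqrt l \<le> heat f l / Psi_ext 1 + \<eta> * l + (2 * d + sqrt e)"
        using h \<eta>l d by linarith
      moreover have "attains f l (sqrt l)" using False l by (intro attains_sqrt) auto
      ultimately show ?thesis using attains_mono by blast
    qed
  qed
  {
    case 0
    then show ?case by (intro small) auto
  next
    case (Suc n)
    show ?case
    proof (cases "sqrt l \<le> \<bar>f\<bar> \<or> l \<le> e")
      case True
      then show ?thesis using Suc.prems by (intro small) auto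
    next
      case False
      define \<mu> where "\<mu> = l - d\<^sup>2"
      have le: "e < l" "\<bar>f\<bar> < sqrt l" using False by auto
      \<comment> \<open>\<open>2 * d^2 <= e\<close> keeps \<open>\<mu>\<close> at least
        \<open>e / 2\<close>; with \<open>4 * d <= \<eta> * e\<close> the cubic loss is then at most
        \<open>\<eta> * d^2\<close>.\<close>
      have \<mu>: "0 < \<mu>" "e / 2 \<le> \<mu>" "\<mu> \<le> e + real n * d\<^sup>2" "d\<^sup>2 < l"
        using d e le Suc.prems by (auto simp: \<mu>_def algebra_simps)
      \<comment> \<open>One step moves \<open>f\<close> by \<open>d\<close> and lowers
        \<open>sqrt l\<close> by at most \<open>d\<close>, whence the overshoot
        \<open>2 * d\<close>.\<close>
      have "sqrt l \<le> sqrt \<mu> + sqrt (d\<^sup>2)"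
        using sqrt_add_le_add_sqrt[of \<mu> "d\<^sup>2"] \<mu> by (simp add: \<mu>_def)
      then have "sqrt l \<le> sqrt \<mu> + d" using d by simp
      then have "\<bar>f + d\<bar> \<le> sqrt \<mu> + 2 * d" "\<bar>f - d\<bar> \<le> sqrt \<mu> + 2 * d"
        using le d by linarith+
      then have "attains (f + d) \<mu> (heat (f + d) \<mu> / Psi_ext 1 + \<eta> * \<mu> + (2 * d + sqrt e))"
        "attains (f - d) \<mu> (heat (f - d) \<mu> / Psi_ext 1 + \<eta> * \<mu> + (2 * d + sqrt e))"
        using \<mu> by (auto intro: Suc.IH)
      note step = attains_step[OF this[unfolded \<mu>_def], folded \<mu>_def]
      have "(heat (f + d) \<mu> + heat (f - d) \<mu>) / 2 \<le> heat f l + 2 * d ^ 3 / \<mu>"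
        using heat_midpoint_upper[OF d(1) \<mu>(4)] by (simp add: \<mu>_def)
      also have "2 * d ^ 3 / \<mu> \<le> \<eta> * d\<^sup>2"
      proof -
        have "2 * d ^ 3 = d\<^sup>2 * (2 * d)" by (simp add: power3_eq_cube power2_eq_square)
        also have "\<dots> \<le> d\<^sup>2 * (\<eta> * \<mu>)"
        proof (intro mult_left_mono)
          have "\<eta> * (e / 2) \<le> \<eta> * \<mu>" using \<mu> \<eta> by (intro mult_left_mono) auto
          then show "2 * d \<le> \<eta> * \<mu>" using d by simp
        qed simp
        finally show ?thesis using \<mu> by (simp add: divide_le_eq mult_ac)
      qed
      finally have "(heat (f + d) \<mu> + heat (f - d) \<mu>) / 2 / Psi_ext 1
          \<le> (heat f l + \<eta> * d\<^sup>2) / Psi_ext 1"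
        using Psi_ext_pos[of 1] by (intro divide_right_mono) auto
      moreover have "\<eta> * d\<^sup>2 / Psi_ext 1 \<le> \<eta> * d\<^sup>2"
        using Psi_ext_ge_1[of 1] Psi_ext_pos[of 1] \<eta>
          mult_left_mono[of 1 "Psi_ext 1" "\<eta> * d\<^sup>2"] by (simp add: divide_le_eq)
      ultimately have mid: "(heat (f + d) \<mu> / Psi_ext 1 + heat (f - d) \<mu> / Psi_ext 1) / 2
          \<le> heat f l / Psi_ext 1 + \<eta> * d\<^sup>2"
        unfolding add_divide_distrib by (simp add: mult.commute)
      have \<eta>\<mu>: "\<eta> * \<mu> = \<eta> * l - \<eta> * d\<^sup>2" by (simp add: \<mu>_def algebra_simps)
      have "((a + x + c) + (b + x + c)) / 2 \<le> h + y + c"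
        if "(a + b) / 2 \<le> h + z" "x = y - z" for a b c h x y z :: real
        using that by simp
      from this[OF mid \<eta>\<mu>]
      have "((heat (f + d) \<mu> / Psi_ext 1 + \<eta> * \<mu> + (2 * d + sqrt e))
          + (heat (f - d) \<mu> / Psi_ext 1 + \<eta> * \<mu> + (2 * d + sqrt e))) / 2
          \<le> heat f l / Psi_ext 1 + \<eta> * l + (2 * d + sqrt e)" .
      then show ?thesis using attains_mono[OF step] by blast
    qed
  }
qed

lemma attains_bellman_approx:
  assumes "0 < l" "0 < r"
  shows "attains f l (bellman f l + r)"
proof (cases "l \<le> f\<^sup>2")
  case True
  then have "sqrt l \<le> \<bar>f\<bar>" using less_power2_iff_sqrt[of f l] by linarith
  then have "attains f l \<bar>f\<bar>" using assms by (intro attains_above)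
  then show ?thesis by (rule attains_mono) (use True assms in \<open>simp add: bellman_def\<close>)
next
  case False
  \<comment> \<open>\<open>\<eta> * l\<close> and \<open>sqrt e\<close> equal \<open>r / 3\<close>,
    and \<open>2 * d\<close> is at most \<open>r / 3\<close>. The other bounds in \<open>d\<close>
    are the step size conditions of \<open>attains_heat_approx\<close>.\<close>
  define \<eta> e where "\<eta> = r / (3 * l)" and "e = (r / 3)\<^sup>2"
  define d where "d = min (r / 6) (min (sqrt (e / 2)) (\<eta> * e / 4))"
  have e: "0 < e" "0 < \<eta>" using assms by (auto simp: e_def \<eta>_def)
  have d: "0 < d" "d \<le> r / 6" "d \<le> sqrt (e / 2)" "4 * d \<le> \<eta> * e"
    using assms e by (auto simp: d_def)
  have "d\<^sup>2 \<le> (sqrt (e / 2))\<^sup>2" using d by (intro power_mono) auto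
  then have de: "2 * d\<^sup>2 \<le> e" using e by simp
  obtain n where "l / d\<^sup>2 \<le> real n" using real_arch_simple by blast
  then have "l \<le> real n * d\<^sup>2" using d by (simp add: divide_le_eq)
  then have "l \<le> e + real n * d\<^sup>2" using e by simp
  moreover have "\<bar>f\<bar> \<le> sqrt l + 2 * d"
    using False less_power2_iff_sqrt[of f l] d by linarith
  ultimately have "attains f l (heat f l / Psi_ext 1 + \<eta> * l + (2 * d + sqrt e))"
    using assms e d de by (intro attains_heat_approx[of e \<eta> d l n f]) auto
  moreover have "heat f l / Psi_ext 1 + \<eta> * l + (2 * d + sqrt e) \<le> bellman f l + r"
    using False assms d by (simp add: bellman_def \<eta>_def e_def)
  ultimately show ?thesis by (rule attains_mono)
qed

text \<open>Witnesses from \<open>attains\<close> satisfy the bound everywhere and so belong to the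
  almost-everywhere class; their excess \<open>r\<close> tends to 0.\<close>

lemma LLb_eq_bellman:
  assumes "J \<in> dyadic" "0 < l"
  shows "LLb J f l = ereal (bellman f l)"
proof -
  obtain m k where J: "J = dyint m k" using assms(1) by (rule dyadicE)
  define X where "X = {\<phi>. integrable_supported J \<phi> \<and> avg \<phi> J = f \<and>
       (AE x in lebesgue. x \<in> J \<longrightarrow> sq_fun2 J \<phi> x \<ge> ennreal l)}"
  have lower: "bellman f l \<le> avg (\<lambda>x. \<bar>\<phi> x\<bar>) J" if "\<phi> \<in> X" for \<phi>
  proof -
    have \<phi>: "integrable lebesgue \<phi>" "avg \<phi> J = f"
      "AE x in lebesgue. x \<in> J \<longrightarrow> sq_fun2 J \<phi> x \<ge> ennreal l"
      using that by (auto simp: X_def integrable_supported_def)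
    from bellman_le_avg_abs[OF \<phi>(1) \<phi>(3)[unfolded J]] \<phi>(2) show ?thesis
      by (simp only: J)
  qed
  have upper: "(INF \<phi>\<in>X. ereal (avg (\<lambda>x. \<bar>\<phi> x\<bar>) J)) \<le> ereal (bellman f l) + ereal r"
    if r: "0 < r" for r
  proof -
    obtain \<phi> where \<phi>: "integrable_supported J \<phi>" "avg \<phi> J = f"
      "\<forall>x\<in>J. ennreal l \<le> sq_fun2 J \<phi> x" "avg (\<lambda>x. \<bar>\<phi> x\<bar>) J \<le> bellman f l + r"
      using attains_bellman_approx[OF assms(2) r, of f, unfolded attains_def, rule_format, of m k]
      unfolding J by (elim exE conjE)
    have "\<phi> \<in> X" using \<phi> by (simp add: X_def)
    then have "(INF \<phi>\<in>X. ereal (avg (\<lambda>x. \<bar>\<phi> x\<bar>) J)) \<le> ereal (avg (\<lambda>x. \<bar>\<phi> x\<bar>) J)"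
      by (rule INF_lower)
    also have "\<dots> \<le> ereal (bellman f l) + ereal r" using \<phi>(4) by simp
    finally show ?thesis .
  qed
  have "(INF \<phi>\<in>X. ereal (avg (\<lambda>x. \<bar>\<phi> x\<bar>) J)) = ereal (bellman f l)"
  proof (rule antisym)
    show "(INF \<phi>\<in>X. ereal (avg (\<lambda>x. \<bar>\<phi> x\<bar>) J)) \<le> ereal (bellman f l)"
      by (rule ereal_le_epsilon2) (rule upper)
    show "ereal (bellman f l) \<le> (INF \<phi>\<in>X. ereal (avg (\<lambda>x. \<bar>\<phi> x\<bar>) J))"
      by (rule INF_greatest) (simp add: lower)
  qed
  then show ?thesis unfolding LLb_AE[OF assms(1)] X_def .
qed

theorem theorem3p3:
  fixes f lam :: real and J :: "real set"
  assumes "J \<in> dyadic" and "lam > 0"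
  shows "LLb J f lam = LL J f 1 lam \<and>
         LL J f 1 lam = ereal (if \<bar>f\<bar> < sqrt lam then sqrt lam * Psi (\<bar>f\<bar> / sqrt lam) / Psi 1 else \<bar>f\<bar>) \<and>
         (if \<bar>f\<bar> < sqrt lam then sqrt lam * Psi (\<bar>f\<bar> / sqrt lam) / Psi 1 else \<bar>f\<bar>)
           = sqrt lam * max (Psi (\<bar>f\<bar> / sqrt lam) / Psi 1) (\<bar>f\<bar> / sqrt lam)"
proof -
  have Psi: "Psi (\<bar>f\<bar> / sqrt lam) = Psi_ext (f / sqrt lam)" "Psi 1 = Psi_ext 1"
    using assms Psi_ext_abs[of "f / sqrt lam"] by (simp_all add: Psi_eq_Psi_ext)
  let ?b = "if \<bar>f\<bar> < sqrt lam then sqrt lam * Psi (\<bar>f\<bar> / sqrt lam) / Psi 1 else \<bar>f\<bar>"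
  have b: "?b = bellman f lam"
    using less_power2_iff_sqrt[of f lam] unfolding Psi bellman_def heat_def by auto
  have pos: "0 < sqrt lam" using assms by simp
  have "sqrt lam * max (Psi (\<bar>f\<bar> / sqrt lam) / Psi 1) (\<bar>f\<bar> / sqrt lam)
      = max (heat f lam / Psi_ext 1) \<bar>f\<bar>"
    unfolding Psi using pos by (simp add: max_mult_distrib_left heat_def)
  \<comment> \<open>\<open>bellman\<close> dominates both arguments of \<open>max\<close> and equals
    one of them.\<close>
  also have "\<dots> = bellman f lam"
    using heat_le_bellman[OF assms(2), of f] abs_le_bellman[of f lam]
    unfolding bellman_def by (auto split: if_splits)
  finally show ?thesis
    using LLb_eq_bellman[OF assms, of f] unfolding b LLb_def by simp
qed

end
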